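(* Let $G$ be a connected graph with a cut-vertex. Then $G$ is $2$-$\gamma_{\rm MB}'$-critical if and only if $G \in \mathcal{F}\cup\mathcal{F}'$.
   Context: All graphs are finite and simple; equality of graphs and membership in a family are meant up to isomorphism. A vertex $x$ of a connected graph $G$ is a cut-vertex if $G-x$ is not connected. A set $D\subseteq V(G)$ is a dominating set of $G$ if every vertex of $V(G)-D$ has a neighbor in $D$. Maker-Breaker domination game (S-game): two players, Dominator and Staller, alternately select a vertex of $G$ that has not been selected before, with Staller moving first. Dominator's goal is that at some point the set of vertices he has selected is a dominating set of $G$; Staller's goal is to prevent this. The game ends when one of the players accomplishes the goal. If Dominator wins the S-game on $G$ under optimal play, then $\gamma_{\rm MB}'(G)$ is the number of moves Dominator makes when both players play optimally (Dominator wants to minimize the number of his moves, Staller wants to maximize it); equivalently, it is the least $k$ such that Dominator has a strategy guaranteeing that he has selected a dominating set after at most $k$ of his moves. If Staller wins, $\gamma_{\rm MB}'(G)=\infty$. A graph $G$ is $2$-$\gamma_{\rm MB}'$-critical if $\gamma_{\rm MB}'(G)=2$ and $\gamma_{\rm MB}'(G-e)>2$ for every $e\in E(G)$, where $G-e$ is obtained from $G$ by deleting the edge $e$ (and $\infty>2$). The join $G\vee H$ is obtained from the disjoint union of $G$ and $H$ by adding all edges $uv$ with $u\in V(G)$, $v\in V(H)$. For $m\ge 2$ let $H_m=K_2\vee \overline{K_{m-2}}$ (so $H_2=K_2$), a graph on $m$ vertices; $H_0$ is the graph with no vertices. Family $\mathcal{F}$: let $t\ge 1$ be an integer and let $m_1\le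 m_2$ be integers with $m_1\in\{0,2,3,4,\ldots\}$ and $m_2\ge 2$; if $m_1=0$, assume in addition $t\ge 2$. Let $\{v_1,v_2\}$ and $B$ be independent sets of vertices, $v_1\neq v_2$, $|B|=t$. The graph $F_{m_1,t,m_2}$ is obtained from the disjoint union of $H_{m_1}$, $H_{m_2}$, $B$ and $\{v_1,v_2\}$ by adding an edge between $v_1$ and each vertex of $H_{m_1}$, an edge between $v_2$ and each vertex of $H_{m_2}$, and all edges between $\{v_1,v_2\}$ and $B$. The family $\mathcal{F}$ consists of all graphs $F_{m_1,t,m_2}$ with such $m_1,t,m_2$. Family $\mathcal{F}'$: let $s,q,m\ge 2$ be integers. Let $P$ be the graph obtained from $K_{2,s}$, where $\{a,b\}$ is a part of size $2$ of its bipartition, by adding $q-2$ isolated vertices $b_1,\ldots,b_{q-2}$. Let $Q=K_1\vee P$. The graph $F'_{s,q,m}$ is obtained from the disjoint union of $Q$ and $H_m$ by adding a new vertex $x$ and joining it by an edge to each vertex in $V(H_m)\cup\{a,b,b_1,\ldots,b_{q-2}\}$. The family $\mathcal{F}'$ consists of all graphs $F'_{s,q,m}$ with $s,q,m\ge 2$. *)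

theory Defs
  imports "Graph_Theory.Graph_Theory" "HOL-Library.Extended_Nat"
begin

text \<open>
  Finite simple graphs are the AFP's pair graphs: an undirected edge \<open>uv\<close> is the pair of arcs
  \<open>(u,v)\<close>, \<open>(v,u)\<close>. The graph theory below is only meaningful under \<^locale>\<open>pair_graph\<close>.
\<close>

text \<open>
  In the library the graph without vertices is not connected, so by this definition the vertex of
  \<open>K\<^sub>1\<close> counts as a cut-vertex. No other graph is affected by this convention.
\<close>

definition cut_vertex :: "'a pair_pre_digraph \<Rightarrow> 'a \<Rightarrow> bool" where
  "cut_vertex G x \<longleftrightarrow> x \<in> pverts G \<and> Digraph_Component.connected (with_proj G) \<and>
     \<not> Digraph_Component.connected (pre_digraph.del_vert (with_proj G) x)"

definition delete_edge :: "'a pair_pre_digraph \<Rightarrow> 'a \<times> 'a \<Rightarrow> 'a pair_pre_digraph" where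
  "delete_edge G e = G\<lparr>parcs := parcs G - {e, prod.swap e}\<rparr>"

definition dominating_set :: "'a pair_pre_digraph \<Rightarrow> 'a set \<Rightarrow> bool" where
  "dominating_set G D \<longleftrightarrow>
     D \<subseteq> pverts G \<and> (\<forall>v \<in> pverts G - D. \<exists>u \<in> D. (v, u) \<in> parcs G)"


section \<open>The Maker-Breaker domination game, Staller moving first\<close>

text \<open>
  A history is the list of the vertices selected so far, in order. Staller's moves are at the even
  positions 0, 2, ..., Dominator's at the odd positions 1, 3, .... Histories may run on until all
  vertices are selected; moves made after the game has been decided do not affect its outcome,
  since a superset of a dominating set is dominating.
\<close>

definition history :: "'a pair_pre_digraph \<Rightarrow> 'a list \<Rightarrow> bool" where
  "history G h \<longleftrightarrow> distinct h \<and> set h \<subseteq> pverts G"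

definition dominator_selection :: "'a list \<Rightarrow> 'a set" where
  "dominator_selection h = {h ! i | i. i < length h \<and> odd i}"

definition follows :: "('a list \<Rightarrow> 'a) \<Rightarrow> 'a list \<Rightarrow> bool" where
  "follows \<sigma> h \<longleftrightarrow> (\<forall>i < length h. odd i \<longrightarrow> h ! i = \<sigma> (take i h))"

definition dominator_strategy :: "'a pair_pre_digraph \<Rightarrow> ('a list \<Rightarrow> 'a) \<Rightarrow> bool" where
  "dominator_strategy G \<sigma> \<longleftrightarrow>
     (\<forall>h. history G h \<and> follows \<sigma> h \<and> odd (length h) \<and> set h \<noteq> pverts G
        \<longrightarrow> \<sigma> h \<in> pverts G - set h)"

text \<open>The first \<open>k\<close> moves of Dominator are among the first \<open>2 * k\<close> moves of the game.\<close>

definition wins_within :: "'a pair_pre_digraph \<Rightarrow> ('a list \<Rightarrow> 'a) \<Rightarrow> nat \<Rightarrow> bool" where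
  "wins_within G \<sigma> k \<longleftrightarrow>
     (\<forall>h. history G h \<and> follows \<sigma> h \<and> set h = pverts G
        \<longrightarrow> dominating_set G (dominator_selection (take (2 * k) h)))"

text \<open>The value is \<open>\<infinity>\<close>, the infimum of the empty set, if Dominator cannot win.\<close>

definition mb_number :: "'a pair_pre_digraph \<Rightarrow> enat" where
  "mb_number G = Inf {enat k | k. \<exists>\<sigma>. dominator_strategy G \<sigma> \<and> wins_within G \<sigma> k}"

definition mb_critical :: "enat \<Rightarrow> 'a pair_pre_digraph \<Rightarrow> bool" where
  "mb_critical k G \<longleftrightarrow>
     mb_number G = k \<and> (\<forall>e \<in> parcs G. mb_number (delete_edge G e) > k)"


section \<open>The two families\<close>

definition edgeless_graph :: "'a set \<Rightarrow> 'a pair_pre_digraph" where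
  "edgeless_graph A = \<lparr>pverts = A, parcs = {}\<rparr>"

definition complete_graph :: "'a set \<Rightarrow> 'a pair_pre_digraph" where
  "complete_graph A = \<lparr>pverts = A, parcs = {(u, v) \<in> A \<times> A. u \<noteq> v}\<rparr>"

definition both_ways :: "'a rel \<Rightarrow> 'a rel" where
  "both_ways R = R \<union> R\<inverse>"

definition disjoint_union ::
    "'a pair_pre_digraph \<Rightarrow> 'b pair_pre_digraph \<Rightarrow> ('a + 'b) pair_pre_digraph" where
  "disjoint_union G H =
     \<lparr>pverts = pverts G <+> pverts H,
      parcs = map_prod Inl Inl ` parcs G \<union> map_prod Inr Inr ` parcs H\<rparr>"

definition join ::
    "'a pair_pre_digraph \<Rightarrow> 'b pair_pre_digraph \<Rightarrow> ('a + 'b) pair_pre_digraph" where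
  "join G H =
     \<lparr>pverts = pverts G <+> pverts H,
      parcs = parcs (disjoint_union G H) \<union> both_ways (Inl ` pverts G \<times> Inr ` pverts H)\<rparr>"

text \<open>Only used for \<open>m = 0\<close> and \<open>m \<ge> 2\<close>.\<close>

definition H_graph :: "nat \<Rightarrow> (nat + nat) pair_pre_digraph" where
  "H_graph m = (if m = 0 then edgeless_graph {}
     else join (complete_graph {..<2}) (edgeless_graph {..<m - 2}))"

datatype F_vertex = FH1 "nat + nat" | FH2 "nat + nat" | FB nat | FV1 | FV2

definition F_graph :: "nat \<Rightarrow> nat \<Rightarrow> nat \<Rightarrow> F_vertex pair_pre_digraph" where
  "F_graph m1 t m2 =
     \<lparr>pverts = FH1 ` pverts (H_graph m1) \<union> FH2 ` pverts (H_graph m2) \<union> FB ` {..<t} \<union> {FV1, FV2},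
      parcs = map_prod FH1 FH1 ` parcs (H_graph m1) \<union> map_prod FH2 FH2 ` parcs (H_graph m2)
        \<union> both_ways ({FV1} \<times> FH1 ` pverts (H_graph m1)
            \<union> {FV2} \<times> FH2 ` pverts (H_graph m2)
            \<union> {FV1, FV2} \<times> FB ` {..<t})\<rparr>"

definition in_family_F :: "'a pair_pre_digraph \<Rightarrow> bool" where
  "in_family_F G \<longleftrightarrow>
     (\<exists>m1 t m2. t \<ge> 1 \<and> m1 \<le> m2 \<and> (m1 = 0 \<or> m1 \<ge> 2) \<and> m2 \<ge> 2 \<and> (m1 = 0 \<longrightarrow> t \<ge> 2) \<and>
        digraph_iso (with_proj G) (with_proj (F_graph m1 t m2)))"

text \<open>
  In \<open>P_graph s q\<close> the part \<open>{a, b}\<close> of \<open>K\<^bsub>2,s\<^esub>\<close> is \<open>Inl ` Inl ` {..<2}\<close>, and the isolated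
  vertices are \<open>Inr ` {..<q - 2}\<close>.
\<close>

definition P_graph :: "nat \<Rightarrow> nat \<Rightarrow> ((nat + nat) + nat) pair_pre_digraph" where
  "P_graph s q =
     disjoint_union (join (edgeless_graph {..<2}) (edgeless_graph {..<s})) (edgeless_graph {..<q - 2})"

definition Q_graph :: "nat \<Rightarrow> nat \<Rightarrow> (unit + ((nat + nat) + nat)) pair_pre_digraph" where
  "Q_graph s q = join (complete_graph {()}) (P_graph s q)"

datatype F'_vertex = FQ "unit + ((nat + nat) + nat)" | FH "nat + nat" | FX

definition F'_graph :: "nat \<Rightarrow> nat \<Rightarrow> nat \<Rightarrow> F'_vertex pair_pre_digraph" where
  "F'_graph s q m =
     \<lparr>pverts = FQ ` pverts (Q_graph s q) \<union> FH ` pverts (H_graph m) \<union> {FX},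
      parcs = map_prod FQ FQ ` parcs (Q_graph s q) \<union> map_prod FH FH ` parcs (H_graph m)
        \<union> both_ways ({FX} \<times>
            (FH ` pverts (H_graph m) \<union> FQ ` Inr ` (Inl ` Inl ` {..<2} \<union> Inr ` {..<q - 2})))\<rparr>"

definition in_family_F' :: "'a pair_pre_digraph \<Rightarrow> bool" where
  "in_family_F' G \<longleftrightarrow>
     (\<exists>s q m. s \<ge> 2 \<and> q \<ge> 2 \<and> m \<ge> 2 \<and> digraph_iso (with_proj G) (with_proj (F'_graph s q m)))"

end

theory Submission
  imports Defs
begin

text \<open>
  Dominator wins within two moves iff after each first move \<open>s\<close> of Staller he can select a vertex \<open>p \<noteq> s\<close>
  that is dominating or belongs to two dominating pairs \<open>{p, q}\<close>, \<open>{p, q'}\<close> avoiding \<open>s\<close>. For a cut-vertex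
  \<open>x\<close>, split the other vertices into two nonempty sides \<open>A\<close>, \<open>B\<close> without edges between them. A dominating
  pair avoiding \<open>x\<close> consists of a vertex adjacent to all of \<open>A\<close> and one adjacent to all of \<open>B\<close>, so the move
  \<open>s = x\<close> yields one such vertex \<open>d\<close> on one side and two on the other. The move \<open>s = d\<close> then forces a
  spanning subgraph from one of the two families, which is all of the graph by criticality. Conversely, in a
  member of the families the first moves \<open>x\<close> and \<open>d\<close> leave Dominator no surplus dominating pair, and each
  edge is needed for one of those pairs.
\<close>

section \<open>Winning within two moves\<close>

text \<open>The forward direction only has to establish the edges of a shape; its non-edges then
  come for free. The obstacle is that the move \<open>d\<close> is forcing only if universal
  vertices (those adjacent to all others of their side) are scarce. All members of both families are
  handled as one parametrised graph, since the same pairs around \<open>x\<close> and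
  \<open>d\<close> govern them; they differ only in where two hubs \<open>y\<close>,
  \<open>y'\<close> lie and in whether a set \<open>R\<close> is empty. The \<open>x\<close> of that
  graph need not be the given cut-vertex: if both sides have several universal vertices, the given
  one becomes the only common neighbour of the graph's \<open>x\<close> and
  \<open>d\<close>.\<close>

definition dominator_wins_within :: "'a pair_pre_digraph \<Rightarrow> nat \<Rightarrow> bool" where
  "dominator_wins_within G k \<longleftrightarrow> (\<exists>\<sigma>. dominator_strategy G \<sigma> \<and> wins_within G \<sigma> k)"

lemma dominating_set_superset:
  assumes "dominating_set G D" "D \<subseteq> D'" "D' \<subseteq> pverts G"
  shows "dominating_set G D'"
  using assms unfolding dominating_set_def by blast

lemma dominator_selection_take_mono:
  assumes "m \<le> n"
  shows "dominator_selection (take m h) \<subseteq> dominator_selection (take n h)"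
proof
  fix v assume "v \<in> dominator_selection (take m h)"
  then obtain i where "i < length h" "i < m" "odd i" "v = h ! i"
    unfolding dominator_selection_def by auto
  then show "v \<in> dominator_selection (take n h)"
    using assms unfolding dominator_selection_def by (auto intro!: exI[of _ i])
qed

lemma dominator_selection_subset: "dominator_selection h \<subseteq> set h"
  unfolding dominator_selection_def by auto

lemma dominator_wins_within_mono:
  assumes "dominator_wins_within G k" "k \<le> l"
  shows "dominator_wins_within G l"
proof -
  obtain \<sigma> where \<sigma>: "dominator_strategy G \<sigma>" "wins_within G \<sigma> k"
    using assms(1) unfolding dominator_wins_within_def by blast
  have "dominating_set G (dominator_selection (take (2 * l) h))"
    if h: "history G h" "follows \<sigma> h" "set h = pverts G" for h
  proof (rule dominating_set_superset)
    show "dominating_set G (dominator_selection (take (2 * k) h))"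
      using \<sigma>(2) h unfolding wins_within_def by blast
    show "dominator_selection (take (2 * k) h) \<subseteq> dominator_selection (take (2 * l) h)"
      using assms(2) by (intro dominator_selection_take_mono) simp
    show "dominator_selection (take (2 * l) h) \<subseteq> pverts G"
      using dominator_selection_subset set_take_subset h(3) by fastforce
  qed
  then show ?thesis
    using \<sigma>(1) unfolding dominator_wins_within_def wins_within_def by blast
qed

text \<open>In \<open>enat\<close> the infimum of a nonempty set is attained, so a finite bound
  yields an actual strategy; monotonicity then carries it up to \<open>k\<close>.\<close>

lemma mb_number_le_iff: "mb_number G \<le> enat k \<longleftrightarrow> dominator_wins_within G k"
proof
  assume le: "mb_number G \<le> enat k"
  let ?S = "{enat k | k. \<exists>\<sigma>. dominator_strategy G \<sigma> \<and> wins_within G \<sigma> k}"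
  have "?S \<noteq> {}"
  proof
    assume "?S = {}"
    then show False using le unfolding mb_number_def by (simp only: Inf_enat_def) simp
  qed
  then have "mb_number G \<in> ?S"
    unfolding mb_number_def by (metis (no_types, lifting) Inf_enat_def LeastI ex_in_conv)
  then obtain l where "mb_number G = enat l" "dominator_wins_within G l"
    unfolding dominator_wins_within_def by blast
  with le show "dominator_wins_within G k"
    using dominator_wins_within_mono by auto
next
  assume "dominator_wins_within G k"
  then show "mb_number G \<le> enat k"
    unfolding mb_number_def dominator_wins_within_def by (intro Inf_lower) blast
qed

section \<open>Plays that follow a strategy\<close>

lemma follows_snoc:
  "follows \<sigma> (h @ [v]) \<longleftrightarrow> follows \<sigma> h \<and> (odd (length h) \<longrightarrow> v = \<sigma> h)"
  unfolding follows_def by (auto simp: nth_append less_Suc_eq)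

text \<open>\<open>wins_within\<close> speaks about complete plays only, so a partial play has to be
  continued before the winning property says anything about it.\<close>

lemma history_extend:
  assumes "finite (pverts G)" "dominator_strategy G \<sigma>" "history G h" "follows \<sigma> h"
  shows "\<exists>h'. history G (h @ h') \<and> follows \<sigma> (h @ h') \<and> set (h @ h') = pverts G"
  using assms(3,4)
proof (induction "card (pverts G - set h)" arbitrary: h rule: less_induct)
  case less
  show ?case
  proof (cases "set h = pverts G")
    case True
    then show ?thesis using less.prems by (intro exI[of _ "[]"]) simp
  next
    case False
    have "\<exists>v \<in> pverts G - set h. odd (length h) \<longrightarrow> v = \<sigma> h"
      using False less.prems assms(2) unfolding dominator_strategy_def history_def by blast
    then obtain v where v: "v \<in> pverts G - set h" "odd (length h) \<longrightarrow> v = \<sigma> h" by blast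
    have "card (pverts G - set (h @ [v])) < card (pverts G - set h)"
      using v(1) assms(1) by (intro psubset_card_mono) auto
    moreover have "history G (h @ [v])" "follows \<sigma> (h @ [v])"
      using less.prems v by (auto simp: history_def follows_snoc)
    ultimately obtain h' where "history G ((h @ [v]) @ h') \<and> follows \<sigma> ((h @ [v]) @ h') \<and>
        set ((h @ [v]) @ h') = pverts G"
      using less.hyps by blast
    then show ?thesis by (intro exI[of _ "v # h'"]) simp
  qed
qed

lemma dominator_selection_less_2: "length h < 2 \<Longrightarrow> dominator_selection h = {}"
  by (auto simp: dominator_selection_def less_2_cases_iff)

lemma dominator_selection_2: "dominator_selection [s, p] = {p}"
  by (auto simp: dominator_selection_def less_Suc_eq intro!: exI[of _ 1])

lemma dominator_selection_3: "dominator_selection [s, p, s'] = {p}"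
  by (auto simp: dominator_selection_def less_Suc_eq intro!: exI[of _ 1])

lemma dominator_selection_4: "dominator_selection [s, p, s', q] = {p, q}"
  by (auto simp: dominator_selection_def less_Suc_eq numeral_3_eq_3 intro: exI[of _ 1] exI[of _ 3])

text \<open>The second disjunct asks for two answers \<open>q, q'\<close> since Staller can select one of them.\<close>

definition two_move_win :: "'a pair_pre_digraph \<Rightarrow> bool" where
  "two_move_win G \<longleftrightarrow> (\<forall>s \<in> pverts G. \<exists>p \<in> pverts G - {s}. dominating_set G {p} \<or>
     (\<exists>q q'. q \<noteq> q' \<and> q \<notin> {s, p} \<and> q' \<notin> {s, p} \<and>
        dominating_set G {p, q} \<and> dominating_set G {p, q'}))"

lemma dominator_wins_within_1D:
  assumes "finite (pverts G)" "pverts G \<noteq> {}" "dominator_wins_within G 1"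
  shows "\<exists>p \<in> pverts G. dominating_set G {p}"
proof -
  obtain \<sigma> where \<sigma>: "dominator_strategy G \<sigma>" "wins_within G \<sigma> 1"
    using assms(3) unfolding dominator_wins_within_def by blast
  obtain h where h: "history G h" "follows \<sigma> h" "set h = pverts G"
    using history_extend[OF assms(1) \<sigma>(1), of "[]"] by (auto simp: history_def follows_def)
  then have dom: "dominating_set G (dominator_selection (take 2 h))"
    using \<sigma>(2) by (auto simp: wins_within_def)
  have "length h \<ge> 2"
  proof (rule ccontr)
    assume "\<not> length h \<ge> 2"
    then have "dominator_selection (take 2 h) = {}" by (intro dominator_selection_less_2) simp
    with dom assms(2) show False by (simp add: dominating_set_def)
  qed
  then obtain s p h' where "h = s # p # h'"
    by (metis One_nat_def Suc_1 Suc_le_length_iff)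
  with dom h(3) show ?thesis by (auto simp: dominator_selection_2)
qed

lemma dominator_wins_within_2D:
  assumes fin: "finite (pverts G)" and win: "dominator_wins_within G 2"
  shows "two_move_win G"
  unfolding two_move_win_def
proof
  fix s assume s: "s \<in> pverts G"
  let ?V = "pverts G"
  obtain \<sigma> where \<sigma>: "dominator_strategy G \<sigma>" "wins_within G \<sigma> 2"
    using win unfolding dominator_wins_within_def by blast
  have move: "\<sigma> h \<in> ?V - set h" if "history G h" "follows \<sigma> h" "odd (length h)" "set h \<noteq> ?V" for h
    using \<sigma>(1) that unfolding dominator_strategy_def by blast
  have dom: "dominating_set G (dominator_selection (take 4 h))"
    if "history G h" "follows \<sigma> h" "set h = ?V" for h
    using \<sigma>(2) that unfolding wins_within_def by auto
  define p where "p = \<sigma> [s]"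
  have h1: "history G [s]" "follows \<sigma> [s]"
    using s by (auto simp: history_def follows_def)
  \<comment> \<open>Otherwise \<open>[s]\<close> is already a complete play in which Dominator has
    selected nothing.\<close>
  have "?V \<noteq> {s}"
  proof
    assume "?V = {s}"
    then have "dominating_set G {}"
      using dom[of "[s]"] h1 by (simp add: dominator_selection_less_2)
    then show False using s by (auto simp: dominating_set_def)
  qed
  then have p: "p \<in> ?V - {s}" using move[of "[s]"] h1 by (auto simp: p_def)
  have h2: "history G [s, p]" "follows \<sigma> [s, p]"
    using s p h1 follows_snoc[of \<sigma> "[s]" p] by (auto simp: history_def p_def)
  show "\<exists>p \<in> ?V - {s}. dominating_set G {p} \<or> (\<exists>q q'. q \<noteq> q' \<and> q \<notin> {s, p} \<and> q' \<notin> {s, p} \<and>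
        dominating_set G {p, q} \<and> dominating_set G {p, q'})"
  proof (cases "dominating_set G {p}")
    case True
    then show ?thesis using p by blast
  next
    case False
    have reply: "\<exists>q. q \<notin> {s, p, s'} \<and> dominating_set G {p, q}" if s': "s' \<in> ?V - {s, p}" for s'
    proof -
      have h3: "history G [s, p, s']" "follows \<sigma> [s, p, s']"
        using s p s' h2 follows_snoc[of \<sigma> "[s, p]" s'] by (auto simp: history_def)
      have "set [s, p, s'] \<noteq> ?V"
        using dom[OF h3] False by (auto simp: dominator_selection_3)
      then have q: "\<sigma> [s, p, s'] \<in> ?V - {s, p, s'}" (is "?q \<in> _")
        using move[OF h3] by simp
      then have "history G [s, p, s', ?q]" "follows \<sigma> [s, p, s', ?q]"
        using h3 follows_snoc[of \<sigma> "[s, p, s']" ?q] by (auto simp: history_def)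
      from history_extend[OF fin \<sigma>(1) this]
      obtain h' where "history G ([s, p, s', ?q] @ h')" "follows \<sigma> ([s, p, s', ?q] @ h')"
        "set ([s, p, s', ?q] @ h') = ?V" by blast
      from dom[OF this] have "dominating_set G {p, ?q}" by (simp add: dominator_selection_4)
      then show ?thesis using q by blast
    qed
    have "?V \<noteq> {s, p}"
      using dom[OF h2] False by (auto simp: dominator_selection_2)
    then obtain s' where s': "s' \<in> ?V - {s, p}" using s p by blast
    obtain q where q: "q \<notin> {s, p, s'}" "dominating_set G {p, q}" using reply[OF s'] by blast
    \<comment> \<open>Staller's second move is now \<open>q\<close> itself, which forces an answer
      different from \<open>q\<close>.\<close>
    then have "q \<in> ?V - {s, p}" by (auto simp: dominating_set_def)
    from reply[OF this] obtain q' where q': "q' \<notin> {s, p, q}" "dominating_set G {p, q'}" by blast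
    have "q \<noteq> q' \<and> q \<notin> {s, p} \<and> q' \<notin> {s, p} \<and> dominating_set G {p, q} \<and> dominating_set G {p, q'}"
      using q q' by auto
    then show ?thesis using p by metis
  qed
qed

lemma dominator_wins_within_2I:
  assumes win: "two_move_win G"
  shows "dominator_wins_within G 2"
proof -
  let ?V = "pverts G"
  let ?pair = "\<lambda>s p q q'. q \<noteq> q' \<and> q \<notin> {s, p} \<and> q' \<notin> {s, p} \<and>
        dominating_set G {p, q} \<and> dominating_set G {p, q'}"
  obtain P where P: "\<forall>s \<in> ?V. P s \<in> ?V - {s} \<and> (dominating_set G {P s} \<or> (\<exists>q q'. ?pair s (P s) q q'))"
    using bchoice[OF win[unfolded two_move_win_def Bex_def]] by blast
  define Q where "Q s s' = (SOME q. q \<notin> {s, P s, s'} \<and> dominating_set G {P s, q})" for s s'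
  define choice where "choice h = (if length h = 1 then P (h ! 0) else Q (h ! 0) (h ! 2))" for h
  \<comment> \<open>A strategy must name a free vertex at every odd history, even after the game is
    decided; where \<open>choice\<close> does not, an arbitrary free vertex serves.\<close>
  define \<sigma> where "\<sigma> h = (if choice h \<in> ?V - set h then choice h else SOME v. v \<in> ?V - set h)" for h
  have "dominator_strategy G \<sigma>"
    unfolding dominator_strategy_def
  proof (intro allI impI)
    fix h assume "history G h \<and> follows \<sigma> h \<and> odd (length h) \<and> set h \<noteq> ?V"
    then have "\<exists>v. v \<in> ?V - set h" unfolding history_def by blast
    then have "(SOME v. v \<in> ?V - set h) \<in> ?V - set h" by (rule someI_ex)
    then show "\<sigma> h \<in> ?V - set h" unfolding \<sigma>_def by (simp del: Diff_iff)
  qed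
  moreover have "dominating_set G (dominator_selection (take (2 * 2) h))"
    if h: "history G h" "follows \<sigma> h" "set h = ?V" for h
  proof (cases "?V = {}")
    case True
    then show ?thesis
      using h dominator_selection_subset[of "take 4 h"] by (auto simp: dominating_set_def)
  next
    case False
    have len: "length h = card ?V" using h unfolding history_def by (metis distinct_card)
    have sel: "dominator_selection (take 4 h) \<subseteq> ?V"
      using dominator_selection_subset[of "take 4 h"] set_take_subset[of 4 h] h(3) by blast
    have fin: "finite ?V" using h(3) by (metis finite_set)
    from False h(3) obtain s h1 where h1: "h = s # h1" by (cases h) auto
    then have s: "s \<in> ?V" using h(3) by auto
    note Ps = P[rule_format, OF s]
    have "?V \<noteq> {s}" using Ps by auto
    then have "h1 \<noteq> []" using h(3) h1 by auto
    then obtain p h2 where h2: "h = s # p # h2" using h1 by (cases h1) auto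
    have "p = \<sigma> [s]"
      using h(2)[unfolded follows_def, rule_format, of 1] by (simp add: h2)
    then have p: "p = P s" using Ps by (auto simp: \<sigma>_def choice_def)
    show ?thesis
    proof (cases "dominating_set G {p}")
      case True
      have "{p} \<subseteq> dominator_selection (take 4 h)"
        using dominator_selection_take_mono[of 2 4 h] by (simp add: h2 dominator_selection_2)
      from dominating_set_superset[OF True this sel] show ?thesis by simp
    next
      case False
      then obtain q q' where q: "?pair s p q q'" using Ps p by blast
      \<comment> \<open>Four distinct vertices guarantee that the play does not end before
        Dominator's second move.\<close>
      then have "card {s, p, q, q'} = 4" using Ps p by auto
      moreover have "{s, p, q, q'} \<subseteq> ?V" using q Ps p s by (auto simp: dominating_set_def)
      ultimately have "length h \<ge> 4" using card_mono[OF fin] len by metis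
      then obtain s' q0 h4 where h4: "h = s # p # s' # q0 # h4"
        using h2 by (auto simp: numeral_eq_Suc Suc_le_length_iff)
      have "\<exists>q. q \<notin> {s, P s, s'} \<and> dominating_set G {P s, q}"
        using q p by (cases "s' = q") auto
      from someI_ex[OF this] have Q: "Q s s' \<notin> {s, p, s'}" "dominating_set G {p, Q s s'}"
        unfolding Q_def p by auto
      moreover have "q0 = \<sigma> [s, p, s']"
        using h(2)[unfolded follows_def, rule_format, of 3] by (simp add: h4 numeral_3_eq_3)
      ultimately have "q0 = Q s s'"
        by (auto simp: \<sigma>_def choice_def dominating_set_def)
      then show ?thesis using Q by (simp add: h4 dominator_selection_4)
    qed
  qed
  ultimately show ?thesis
    unfolding dominator_wins_within_def wins_within_def by blast
qed

lemma mb_critical_2_iff: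
  assumes "finite (pverts G)"
  shows "mb_critical 2 G \<longleftrightarrow> two_move_win G \<and> \<not> dominator_wins_within G 1 \<and>
     (\<forall>e \<in> parcs G. \<not> two_move_win (delete_edge G e))"
proof -
  have two: "mb_number K \<le> 2 \<longleftrightarrow> two_move_win K" if "finite (pverts K)" for K :: "'a pair_pre_digraph"
    using mb_number_le_iff[of K 2] dominator_wins_within_2D[OF that] dominator_wins_within_2I[of K]
    unfolding numeral_eq_enat by blast
  have "n = 2 \<longleftrightarrow> n \<le> 2 \<and> \<not> n \<le> 1" for n :: enat
  proof (cases n)
    case (enat k)
    have "enat k = 2 \<longleftrightarrow> k = 2" "enat k \<le> 2 \<longleftrightarrow> k \<le> 2" by (simp_all add: numeral_eq_enat)
    moreover have "enat k \<le> 1 \<longleftrightarrow> k \<le> 1" unfolding one_enat_def by simp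
    ultimately show ?thesis unfolding enat by linarith
  qed simp
  then have "mb_number G = 2 \<longleftrightarrow> two_move_win G \<and> \<not> dominator_wins_within G 1"
    using two[OF assms] mb_number_le_iff[of G 1] one_enat_def by metis
  then show ?thesis
    unfolding mb_critical_def using two assms by (auto simp: delete_edge_def not_le[symmetric])
qed

section \<open>The common shape of the two families\<close>

lemma dominating_set_pair_iff:
  "dominating_set G {p, q} \<longleftrightarrow> p \<in> pverts G \<and> q \<in> pverts G \<and>
     (\<forall>v \<in> pverts G. v = p \<or> v = q \<or> (v, p) \<in> parcs G \<or> (v, q) \<in> parcs G)"
  unfolding dominating_set_def by auto

lemma dominating_set_mono:
  assumes "dominating_set G D" "pverts G = pverts G'" "parcs G \<subseteq> parcs G'"
  shows "dominating_set G' D"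
  using assms unfolding dominating_set_def by blast

lemma two_move_win_mono:
  assumes "two_move_win G" "pverts G = pverts G'" "parcs G \<subseteq> parcs G'"
  shows "two_move_win G'"
  unfolding two_move_win_def
proof
  fix s assume "s \<in> pverts G'"
  then obtain p where p: "p \<in> pverts G - {s}" "dominating_set G {p} \<or>
     (\<exists>q q'. q \<noteq> q' \<and> q \<notin> {s, p} \<and> q' \<notin> {s, p} \<and>
        dominating_set G {p, q} \<and> dominating_set G {p, q'})"
    using assms(1,2) unfolding two_move_win_def by blast
  then show "\<exists>p \<in> pverts G' - {s}. dominating_set G' {p} \<or>
     (\<exists>q q'. q \<noteq> q' \<and> q \<notin> {s, p} \<and> q' \<notin> {s, p} \<and>
        dominating_set G' {p, q} \<and> dominating_set G' {p, q'})"
    using dominating_set_mono[OF _ assms(2,3)] assms(2) by metis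
qed

lemma two_move_winD:
  assumes "two_move_win G" "\<And>p. \<not> dominating_set G {p}" "s \<in> pverts G"
  obtains p q q' where "p \<noteq> s" "q \<noteq> s" "q' \<noteq> s" "q \<noteq> q'"
    "dominating_set G {p, q}" "dominating_set G {p, q'}"
  using assms unfolding two_move_win_def by blast

text \<open>\<open>u\<close>, \<open>u'\<close> are hubs of \<open>H\<close>, while
  \<open>y\<close>, \<open>y'\<close> are hubs for \<open>R\<close> that may lie inside or outside
  it; this freedom lets one graph cover both families. Hubs inside their own set would create loops,
  hence \<open>- Id\<close>.\<close>

definition shape_graph ::
    "'a set \<Rightarrow> 'a \<Rightarrow> 'a \<Rightarrow> 'a \<Rightarrow> 'a \<Rightarrow> 'a set \<Rightarrow> 'a set \<Rightarrow> 'a \<Rightarrow> 'a \<Rightarrow> 'a pair_pre_digraph" where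
  "shape_graph H u u' x d N R y y' =
     \<lparr>pverts = H \<union> {x, d} \<union> N \<union> R,
      parcs = both_ways ({x} \<times> (H \<union> N) \<union> {d} \<times> (N \<union> R) \<union> {u, u'} \<times> H \<union> {y, y'} \<times> R) - Id\<rparr>"

lemma pverts_shape_graph [simp]: "pverts (shape_graph H u u' x d N R y y') = H \<union> {x, d} \<union> N \<union> R"
  by (simp add: shape_graph_def)

text \<open>
  The members of \<open>\<F>\<close> with \<open>m\<^sub>1 \<ge> 2\<close> are the shapes with \<open>y \<in> R\<close>, those with \<open>m\<^sub>1 = 0\<close> are the
  shapes with \<open>R = {}\<close>, and the members of \<open>\<F>'\<close> are the shapes with \<open>y \<in> N\<close> and \<open>R \<noteq> {}\<close>; in each
  case \<open>x\<close> and \<open>H\<close> stand for a cut-vertex and for the graph \<open>H\<^sub>m\<close> attached to it.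
\<close>

locale critical_shape =
  fixes H :: "'a set" and u u' x d :: 'a and N R :: "'a set" and y y' :: 'a
  assumes finite_sets: "finite H" "finite N" "finite R"
    and u: "u \<in> H" "u' \<in> H" "u \<noteq> u'"
    and disjoint: "x \<noteq> d" "x \<notin> H" "x \<notin> N" "x \<notin> R" "d \<notin> H" "d \<notin> N" "d \<notin> R"
      "H \<inter> N = {}" "H \<inter> R = {}" "N \<inter> R = {}"
    and y: "y \<noteq> y'" "y \<in> R \<and> y' \<in> R \<and> N \<noteq> {} \<or> y \<in> N \<and> y' \<in> N \<and> (\<forall>r. R \<noteq> {r})"
begin

abbreviation "K \<equiv> shape_graph H u u' x d N R y y'"

section \<open>Adjacency and dominating pairs in a shape\<close>

lemma adjacent_x: "(v, x) \<in> parcs K \<longleftrightarrow> v \<in> H \<union> N"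
  using disjoint u y(2) unfolding shape_graph_def both_ways_def by auto

lemma adjacent_d: "(v, d) \<in> parcs K \<longleftrightarrow> v \<in> N \<union> R"
  using disjoint u y(2) unfolding shape_graph_def both_ways_def by auto

lemma adjacent_H:
  assumes "h \<in> H"
  shows "(v, h) \<in> parcs K \<longleftrightarrow> v = x \<or> v \<in> H \<and> v \<noteq> h \<and> (h \<in> {u, u'} \<or> v \<in> {u, u'})"
  using disjoint u y(2) assms unfolding shape_graph_def both_ways_def by auto

lemma adjacent_N:
  assumes "n \<in> N"
  shows "(v, n) \<in> parcs K \<longleftrightarrow> v = x \<or> v = d \<or> v \<in> R \<and> n \<in> {y, y'}"
  using disjoint u y(2) assms unfolding shape_graph_def both_ways_def by auto

lemma adjacent_R:
  assumes "r \<in> R"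
  shows "(v, r) \<in> parcs K \<longleftrightarrow> v = d \<or> v \<noteq> r \<and> (v \<in> {y, y'} \<or> v \<in> R \<and> r \<in> {y, y'})"
  using disjoint u y(2) assms unfolding shape_graph_def both_ways_def by auto

lemma N_nonempty: "N \<noteq> {}"
  using y(2) by auto

lemma dominating_pairs:
  "dominating_set K {d, u}" "dominating_set K {d, u'}"
  "dominating_set K {x, d}" "dominating_set K {x, y}" "dominating_set K {x, y'}"
  unfolding dominating_set_pair_iff shape_graph_def both_ways_def using u disjoint y by auto

lemma two_move_win_shape: "two_move_win K"
  unfolding two_move_win_def
proof
  fix s assume "s \<in> pverts K"
  show "\<exists>p \<in> pverts K - {s}. dominating_set K {p} \<or> (\<exists>q q'. q \<noteq> q' \<and> q \<notin> {s, p} \<and> q' \<notin> {s, p} \<and>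
        dominating_set K {p, q} \<and> dominating_set K {p, q'})"
  proof (cases "s = x")
    case True
    have "u \<notin> {s, d}" "u' \<notin> {s, d}" using True disjoint u by auto
    then show ?thesis
      using True disjoint(1) u(3) dominating_pairs(1,2) by (intro bexI[of _ d]) auto
  next
    case False
    have "distinct [x, d, y, y']" using disjoint y by auto
    \<comment> \<open>\<open>x\<close> forms a dominating pair with each of \<open>d\<close>,
      \<open>y\<close>, \<open>y'\<close>, and Staller's move removes at most one of the
      three.\<close>
    then have "\<exists>q q'. q \<noteq> q' \<and> q \<in> {d, y, y'} - {s, x} \<and> q' \<in> {d, y, y'} - {s, x}"
      by (cases "s = d"; cases "s = y") auto
    then show ?thesis
      using False dominating_pairs(3-5) by (intro bexI[of _ x]) auto
  qed
qed

text \<open>\<open>u\<close> can only be dominated from \<open>H \<union> {x}\<close> and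
  \<open>d\<close> only from \<open>{d} \<union> N \<union> R\<close>, so a pair has one vertex in
  each. If the first lies in \<open>H\<close>, it sees nothing of \<open>N \<union> R\<close>, and
  the other has to dominate that whole set, which only \<open>d\<close> does.\<close>

lemma dominating_pair_cases:
  assumes dom: "dominating_set K {p, q}"
  shows "p \<in> H \<and> q = d \<or> p = d \<and> q \<in> H \<or> p = x \<and> q \<in> {d} \<union> N \<union> R \<or> q = x \<and> p \<in> {d} \<union> N \<union> R"
proof -
  have meet: "v \<in> {p, q} \<or> (\<exists>w \<in> {p, q}. (v, w) \<in> parcs K)" if "v \<in> pverts K" for v
    using dom that unfolding dominating_set_pair_iff by blast
  have "(u, w) \<in> parcs K \<Longrightarrow> w \<in> H \<union> {x}" "(d, w) \<in> parcs K \<Longrightarrow> w \<in> {d} \<union> N \<union> R" for w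
    using u disjoint y(2) unfolding shape_graph_def both_ways_def by auto
  then obtain h z where "h \<in> {p, q}" and h: "h \<in> H \<union> {x}" and "z \<in> {p, q}" and z: "z \<in> {d} \<union> N \<union> R"
    using meet[of u] meet[of d] u(1) by auto
  moreover have "h \<noteq> z" using h z disjoint by auto
  ultimately have hz: "{p, q} = {h, z}" by auto
  have "z = d" if h: "h \<in> H"
  proof (rule ccontr)
    assume "z \<noteq> d"
    have all: "v = z \<or> (v, z) \<in> parcs K" if "v \<in> N \<union> R" for v
      using meet[of v] that h adjacent_H[OF h, of v] disjoint unfolding hz by auto
    show False
    proof (cases "z \<in> N")
      case True
      \<comment> \<open>\<open>N\<close> is independent, so \<open>N = {z}\<close>. Then the two
        hubs cannot lie in \<open>N\<close>; thus \<open>z\<close> is no hub and misses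
        \<open>y\<close>.\<close>
      have "n = z" if "n \<in> N" for n
        using all[of n] adjacent_N[OF True, of n] disjoint that by auto
      then have "y \<in> R" using y by metis
      then have "z \<notin> {y, y'}" using y(2) True disjoint by auto
      then show False using all[of y] adjacent_N[OF True, of y] \<open>y \<in> R\<close> True disjoint by auto
    next
      case False
      then have zR: "z \<in> R" using \<open>z \<noteq> d\<close> z by blast
      obtain n where n: "n \<in> N" using N_nonempty by blast
      then have "n \<in> {y, y'}"
        using all[of n] adjacent_R[OF zR, of n] zR disjoint by auto
      then have "y \<in> N" "z \<notin> {y, y'}" using y(2) n zR disjoint by auto
      \<comment> \<open>This is why \<open>R\<close> must not be a singleton: if
        \<open>N = {y, y'}\<close>, a single vertex of \<open>R\<close> would dominate
        \<open>N\<close> and could replace \<open>d\<close>.\<close>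
      then obtain r where r: "r \<in> R" "r \<noteq> z" using y(2) zR disjoint by blast
      then have "r \<notin> {y, y'}" using \<open>y \<in> N\<close> y(2) disjoint by auto
      then show False
        using all[of r] adjacent_R[OF zR, of r] r \<open>z \<notin> {y, y'}\<close> disjoint by auto
    qed
  qed
  then have "h \<in> H \<and> z = d \<or> h = x \<and> z \<in> {d} \<union> N \<union> R" using h z by blast
  moreover have "p = h \<and> q = z \<or> p = z \<and> q = h" using hz by (simp add: doubleton_eq_iff)
  ultimately show ?thesis by blast
qed

lemma no_dominating_vertex: "\<not> dominating_set K {p}"
  using dominating_pair_cases[of p p] disjoint by auto

text \<open>After the deletion, the moves \<open>x\<close> and \<open>d\<close> of Staller still
  need answers, and the possible pairs of the shape allow only two pairs \<open>{d, h}\<close>,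
  \<open>{d, h'}\<close> for the first and two pairs \<open>{x, z}\<close>, \<open>{x, z'}\<close>
  for the second. The absence of any edge of the shape contradicts these four pairs.\<close>

lemma not_two_move_win_delete_edge:
  assumes e: "e \<in> parcs K"
  shows "\<not> two_move_win (delete_edge K e)"
proof
  assume win: "two_move_win (delete_edge K e)"
  let ?D = "delete_edge K e"
  have mono: "dominating_set K D" if "dominating_set ?D D" for D
    using dominating_set_mono[OF that] by (auto simp: delete_edge_def)
  have single: "\<not> dominating_set ?D {p}" for p
    using mono no_dominating_vertex by blast
  have V: "pverts ?D = pverts K" by (simp add: delete_edge_def)
  obtain p q q' where pq: "p \<noteq> x" "q \<noteq> x" "q' \<noteq> x" "q \<noteq> q'"
    "dominating_set ?D {p, q}" "dominating_set ?D {p, q'}"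
    using two_move_winD[OF win single, of x] V by auto
  have "p = d \<and> q \<in> H \<and> q' \<in> H"
    using dominating_pair_cases[OF mono[OF pq(5)]] dominating_pair_cases[OF mono[OF pq(6)]] pq(1-4) disjoint
    by blast
  then obtain h h' where h: "h \<in> H" "h' \<in> H" "h \<noteq> h'"
    "dominating_set ?D {d, h}" "dominating_set ?D {d, h'}"
    using pq by blast
  obtain p q q' where pq: "p \<noteq> d" "q \<noteq> d" "q' \<noteq> d" "q \<noteq> q'"
    "dominating_set ?D {p, q}" "dominating_set ?D {p, q'}"
    using two_move_winD[OF win single, of d] V by auto
  have "p = x \<and> q \<in> N \<union> R \<and> q' \<in> N \<union> R"
    using dominating_pair_cases[OF mono[OF pq(5)]] dominating_pair_cases[OF mono[OF pq(6)]] pq(1-4) disjoint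
    by blast
  then obtain z z' where z: "z \<in> N \<union> R" "z' \<in> N \<union> R" "z \<noteq> z'"
    "dominating_set ?D {x, z}" "dominating_set ?D {x, z'}"
    using pq by blast
  obtain a b where ab: "e = (a, b) \<or> e = (b, a)" "a \<noteq> b"
    "(a, b) \<in> {x} \<times> (H \<union> N) \<union> {d} \<times> (N \<union> R) \<union> {u, u'} \<times> H \<union> {y, y'} \<times> R"
    using e unfolding shape_graph_def both_ways_def by auto
  have arcs: "parcs ?D = parcs K - {(a, b), (b, a)}"
    using ab(1) by (auto simp: delete_edge_def)
  have dom_h: "v = d \<or> v = w \<or> (v, d) \<in> parcs ?D \<or> (v, w) \<in> parcs ?D"
    if "w \<in> {h, h'}" "v \<in> pverts K" for v w
    using that h(4,5) V unfolding dominating_set_pair_iff by blast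
  have dom_z: "v = x \<or> v = w \<or> (v, x) \<in> parcs ?D \<or> (v, w) \<in> parcs ?D"
    if "w \<in> {z, z'}" "v \<in> pverts K" for v w
    using that z(4,5) V unfolding dominating_set_pair_iff by blast
  have R_universal: "v = w \<or> (v, w) \<in> parcs ?D" if "v \<in> R" "w \<in> {z, z'}" for v w
    using dom_z[OF that(2), of v] that(1) arcs adjacent_x[of v] disjoint by auto
  \<comment> \<open>With the hubs in \<open>N\<close> there are no edges inside \<open>R\<close>, so
    a vertex of \<open>R\<close> misses some other vertex of \<open>R\<close>, which
    \<open>x\<close> does not dominate either.\<close>
  have z_in_R: "y \<in> N \<Longrightarrow> w \<notin> R" if "w \<in> {z, z'}" for w
  proof
    assume yN: "y \<in> N" and wR: "w \<in> R"
    then have R: "{y, y'} \<inter> R = {}" and "R \<noteq> {w}" using y(2) disjoint by auto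
    then obtain r where r: "r \<in> R" "r \<noteq> w" using wR by blast
    then have "(r, w) \<in> parcs K" using R_universal[of r w] that arcs by auto
    moreover have "r \<noteq> d" using r(1) disjoint by auto
    ultimately show False
      using adjacent_R[OF wR, of r] R r(1) wR by blast
  qed
  consider "a = x" "b \<in> H" | "a = x" "b \<in> N" | "a = d" "b \<in> N \<union> R"
    | "a \<in> {u, u'}" "b \<in> H" | "a \<in> {y, y'}" "b \<in> R"
    using ab(3) by blast
  then show False
  proof cases
    case 1
    then show False
      using dom_z[of z b] z(1) arcs adjacent_N[of z b] adjacent_R[of z b] disjoint y(2) by auto
  next
    case 2
    obtain w where w: "w \<in> {z, z'}" "w \<noteq> b" using z(3) by blast
    then have "(b, w) \<in> parcs K" using dom_z[of w b] 2 arcs disjoint by auto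
    then have "w \<in> R" "b \<in> {y, y'}"
      using w z(1,2) adjacent_N[of w b] adjacent_R[of w b] 2 disjoint by auto
    moreover have "y \<in> N" using \<open>b \<in> {y, y'}\<close> 2 y(2) disjoint by auto
    ultimately show False using z_in_R w by blast
  next
    case 3
    then show False
      using dom_h[of h b] h(1) arcs adjacent_H[of h b] disjoint by auto
  next
    case 4
    have "a \<in> H" using 4 u by auto
    have H_universal: "v = w \<or> (v, w) \<in> parcs ?D" if "v \<in> H" "w \<in> {h, h'}" for v w
      using dom_h[OF that(2), of v] that(1) arcs adjacent_d[of v] disjoint by auto
    have ne: "w \<noteq> a \<and> w \<noteq> b" if "w \<in> {h, h'}" for w
      using H_universal[OF \<open>a \<in> H\<close> that] H_universal[OF 4(2) that] ab(2) arcs by auto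
    have hub: "w \<in> {u, u'} \<or> v \<in> {u, u'}" if "v \<in> H" "w \<in> {h, h'}" "v \<noteq> w" for v w
    proof -
      have "w \<in> H" using that(2) h(1,2) by blast
      moreover have "(v, w) \<in> parcs K" using H_universal[OF that(1,2)] that(3) arcs by auto
      moreover have "v \<noteq> x" using that(1) disjoint by auto
      ultimately show ?thesis using adjacent_H[of w v] by blast
    qed
    \<comment> \<open>Neither \<open>h\<close> nor \<open>h'\<close> is an end of the deleted edge.
      If \<open>b\<close> is no hub, both must be the hub other than \<open>a\<close>; if
      \<open>b\<close> is a hub, both are non-hubs and hence not adjacent to each other.\<close>
    show False
      using hub[of b h] hub[of b h'] hub[of h h'] ne[of h] ne[of h'] 4 ab(2) h(1-3) by auto
  next
    case 5
    show False
    proof (cases "y \<in> N")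
      case True
      \<comment> \<open>\<open>x\<close> sees nothing of \<open>R\<close>, so \<open>b\<close> needs
        \<open>w\<close>, which must be the hub other than \<open>a\<close>; this leaves one vertex
        for both \<open>z\<close> and \<open>z'\<close>.\<close>
      have "w \<in> {y, y'} - {a}" if w: "w \<in> {z, z'}" for w
      proof -
        have "w \<in> N" using z_in_R[OF w True] w z(1,2) by blast
        then show ?thesis
          using R_universal[OF 5(2) w] arcs adjacent_N[of w b] 5(2) disjoint by auto
      qed
      then show False using 5(1) z(3) by blast
    next
      case False
      then have yR: "y \<in> R" "y' \<in> R" using y(2) by auto
      have zR: "w \<in> R" if w: "w \<in> {z, z'}" for w
        using R_universal[OF yR(1) w] adjacent_N[of w y] yR arcs w z(1,2) disjoint by auto
      have "a \<in> R" using 5 yR by auto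
      have ne: "w \<noteq> a \<and> w \<noteq> b" if "w \<in> {z, z'}" for w
        using R_universal[OF \<open>a \<in> R\<close> that] R_universal[OF 5(2) that] ab(2) arcs by auto
      have hub: "w \<in> {y, y'} \<or> v \<in> {y, y'}" if "v \<in> R" "w \<in> {z, z'}" "v \<noteq> w" for v w
      proof -
        have "(v, w) \<in> parcs K" using R_universal[OF that(1,2)] that(3) arcs by auto
        moreover have "v \<noteq> d" using that(1) disjoint by auto
        ultimately show ?thesis using adjacent_R[OF zR[OF that(2)], of v] by blast
      qed
      show False
        using hub[of b z] hub[of b z'] hub[of z z'] ne[of z] ne[of z'] zR[of z] 5 ab(2) z(3) by auto
    qed
  qed
qed

lemma mb_critical_shape: "mb_critical 2 K"
proof -
  have "finite (pverts K)" using finite_sets by simp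
  moreover have "\<not> dominator_wins_within K 1"
    using dominator_wins_within_1D[OF calculation] no_dominating_vertex by auto
  ultimately show ?thesis
    using mb_critical_2_iff two_move_win_shape not_two_move_win_delete_edge by blast
qed

text \<open>With the hubs inside \<open>R\<close> both ends of the shape have the same structure.
  Exchanging them later provides the order \<open>m1 \<le> m2\<close> of the parameters.\<close>

lemma swap:
  assumes "y \<in> R"
  shows "critical_shape R y y' d x N H u u'"
proof
qed (use assms finite_sets u disjoint y N_nonempty in auto)

lemma shape_graph_swap: "shape_graph R y y' d x N H u u' = K"
  unfolding shape_graph_def by (simp add: Un_ac insert_commute)

end

section \<open>Isomorphism with the families\<close>

definition map_graph :: "('b \<Rightarrow> 'a) \<Rightarrow> 'b pair_pre_digraph \<Rightarrow> 'a pair_pre_digraph" where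
  "map_graph \<phi> G = \<lparr>pverts = \<phi> ` pverts G, parcs = map_prod \<phi> \<phi> ` parcs G\<rparr>"

text \<open>A library isomorphism also maps arcs and carries its own tail and head functions.
  Between pair graphs these must be \<open>fst\<close> and \<open>snd\<close>, so the vertex map
  determines the arc map.\<close>

lemma digraph_iso_with_proj_iff:
  assumes wf: "pair_wf_digraph F"
  shows "digraph_iso (with_proj F) (with_proj G) \<longleftrightarrow> (\<exists>\<phi>. inj_on \<phi> (pverts F) \<and> G = map_graph \<phi> F)"
proof
  assume "digraph_iso (with_proj F) (with_proj G)"
  then obtain f where f: "pre_digraph.digraph_isomorphism (with_proj F) f" "with_proj G = app_iso f (with_proj F)"
    unfolding digraph_iso_def by blast
  have V: "pverts G = iso_verts f ` pverts F" and A: "parcs G = iso_arcs f ` parcs F"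
    and ends: "iso_tail f = fst" "iso_head f = snd"
    using f(2) by (simp_all add: with_proj_def app_iso_def)
  have "iso_arcs f a = map_prod (iso_verts f) (iso_verts f) a" if "a \<in> parcs F" for a
    using f(1) that ends unfolding pre_digraph.digraph_isomorphism_def
    by (simp add: prod_eq_iff)
  then have "G = map_graph (iso_verts f) F"
    using V A by (simp add: map_graph_def cong: image_cong)
  moreover have "inj_on (iso_verts f) (pverts F)"
    using f(1) unfolding pre_digraph.digraph_isomorphism_def by simp
  ultimately show "\<exists>\<phi>. inj_on \<phi> (pverts F) \<and> G = map_graph \<phi> F" by blast
next
  assume "\<exists>\<phi>. inj_on \<phi> (pverts F) \<and> G = map_graph \<phi> F"
  then obtain \<phi> where \<phi>: "inj_on \<phi> (pverts F)" "G = map_graph \<phi> F" by blast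
  let ?f = "\<lparr>iso_verts = \<phi>, iso_arcs = map_prod \<phi> \<phi>, iso_head = snd, iso_tail = fst\<rparr>"
  have "parcs F \<subseteq> pverts F \<times> pverts F"
    using wf unfolding pair_wf_digraph_def by force
  then have "inj_on (map_prod \<phi> \<phi>) (parcs F)"
    using inj_on_subset[OF map_prod_inj_on[OF \<phi>(1) \<phi>(1)]] by blast
  then have "pre_digraph.digraph_isomorphism (with_proj F) ?f"
    using wf \<phi>(1) unfolding pre_digraph.digraph_isomorphism_def
    by (auto simp: wf_digraph_wp_iff)
  moreover have "with_proj G = app_iso ?f (with_proj F)"
    using \<phi>(2) by (simp add: app_iso_def with_proj_def map_graph_def)
  ultimately show "digraph_iso (with_proj F) (with_proj G)"
    unfolding digraph_iso_def by blast
qed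

lemma digraph_iso_with_proj_iff':
  assumes "pair_wf_digraph F" "pair_wf_digraph G"
  shows "digraph_iso (with_proj G) (with_proj F) \<longleftrightarrow> (\<exists>\<phi>. inj_on \<phi> (pverts F) \<and> G = map_graph \<phi> F)"
  using digraph_iso_with_proj_iff[OF assms(1), of G] digraph_iso_swap assms
    wf_digraph_wp_iff[of F] wf_digraph_wp_iff[of G] by metis

text \<open>Injectivity keeps non-loops from becoming loops, so removing the diagonal commutes with
  taking images.\<close>

lemma map_prod_both_ways:
  assumes "inj_on \<phi> V" "S \<subseteq> V \<times> V"
  shows "map_prod \<phi> \<phi> ` (both_ways S - Id) = both_ways (map_prod \<phi> \<phi> ` S) - Id"
proof -
  have "\<phi> a \<noteq> \<phi> b" if "(a, b) \<in> S" "a \<noteq> b" for a b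
    using assms that by (auto dest: inj_onD)
  then show ?thesis unfolding both_ways_def by (force simp: image_iff)
qed

lemma both_ways_subset: "S \<subseteq> V \<times> V \<Longrightarrow> both_ways S \<subseteq> V \<times> V"
  unfolding both_ways_def by blast

context critical_shape
begin

lemma shape_relation_subset:
  "{x} \<times> (H \<union> N) \<union> {d} \<times> (N \<union> R) \<union> {u, u'} \<times> H \<union> {y, y'} \<times> R \<subseteq> pverts K \<times> pverts K"
  using u y(2) by auto

lemma pair_wf_digraph_shape: "pair_wf_digraph K"
proof -
  have "parcs K \<subseteq> pverts K \<times> pverts K"
    using both_ways_subset[OF shape_relation_subset] unfolding shape_graph_def by auto
  then show ?thesis unfolding pair_wf_digraph_def by force
qed

lemma map_graph_shape:
  assumes "inj_on \<phi> (pverts K)"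
  shows "map_graph \<phi> K =
    shape_graph (\<phi> ` H) (\<phi> u) (\<phi> u') (\<phi> x) (\<phi> d) (\<phi> ` N) (\<phi> ` R) (\<phi> y) (\<phi> y')"
proof -
  let ?S = "{x} \<times> (H \<union> N) \<union> {d} \<times> (N \<union> R) \<union> {u, u'} \<times> H \<union> {y, y'} \<times> R"
  have "map_prod \<phi> \<phi> ` (both_ways ?S - Id) = both_ways (map_prod \<phi> \<phi> ` ?S) - Id"
    by (rule map_prod_both_ways[OF assms shape_relation_subset])
  moreover have "map_prod \<phi> \<phi> ` ?S = {\<phi> x} \<times> (\<phi> ` H \<union> \<phi> ` N) \<union> {\<phi> d} \<times> (\<phi> ` N \<union> \<phi> ` R) \<union>
      {\<phi> u, \<phi> u'} \<times> \<phi> ` H \<union> {\<phi> y, \<phi> y'} \<times> \<phi> ` R"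
    by (simp only: image_Un map_prod_surj_on[OF refl refl] image_insert image_empty)
  ultimately show ?thesis
    unfolding map_graph_def by (simp add: shape_graph_def image_Un)
qed

lemma critical_shape_image:
  assumes inj: "inj_on \<phi> (pverts K)"
  shows "critical_shape (\<phi> ` H) (\<phi> u) (\<phi> u') (\<phi> x) (\<phi> d) (\<phi> ` N) (\<phi> ` R) (\<phi> y) (\<phi> y')"
proof -
  have eq: "\<phi> a = \<phi> b \<longleftrightarrow> a = b" if "a \<in> pverts K" "b \<in> pverts K" for a b
    by (rule inj_on_eq_iff[OF inj that])
  have mem: "\<phi> a \<in> \<phi> ` A \<longleftrightarrow> a \<in> A" if "a \<in> pverts K" "A \<subseteq> pverts K" for a A
    by (rule inj_on_image_mem_iff[OF inj that])
  have sub: "H \<subseteq> pverts K" "N \<subseteq> pverts K" "R \<subseteq> pverts K" by auto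
  have V: "u \<in> pverts K" "u' \<in> pverts K" "x \<in> pverts K" "d \<in> pverts K" "y \<in> pverts K" "y' \<in> pverts K"
    using u y(2) by auto
  have int: "\<phi> ` A \<inter> \<phi> ` B = {}" if "A \<inter> B = {}" "A \<subseteq> pverts K" "B \<subseteq> pverts K" for A B
    using inj_on_image_Int[OF inj that(2,3)] that(1) by simp
  have single: "\<phi> ` R \<noteq> {r}" if R: "\<forall>r. R \<noteq> {r}" for r
  proof
    assume r: "\<phi> ` R = {r}"
    then obtain a where a: "a \<in> R" by blast
    have "b = a" if b: "b \<in> R" for b
    proof -
      have "\<phi> b \<in> {r}" "\<phi> a \<in> {r}" using r a b by (metis imageI)+
      then have "\<phi> b = \<phi> a" by simp
      then show ?thesis using inj_onD[OF inj] a b by simp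
    qed
    then have "R = {a}" using a by blast
    then show False using R by simp
  qed
  have y_image: "\<phi> y \<in> \<phi> ` R \<and> \<phi> y' \<in> \<phi> ` R \<and> \<phi> ` N \<noteq> {} \<or>
      \<phi> y \<in> \<phi> ` N \<and> \<phi> y' \<in> \<phi> ` N \<and> (\<forall>r. \<phi> ` R \<noteq> {r})"
    using y(2) single by blast
  show ?thesis
  proof
    show "\<phi> ` H \<inter> \<phi> ` N = {}" "\<phi> ` H \<inter> \<phi> ` R = {}" "\<phi> ` N \<inter> \<phi> ` R = {}"
      using int disjoint(8-10) sub by simp_all
  qed (use y_image finite_sets u disjoint y(1) in \<open>simp_all add: mem[OF V(3) sub(1)] mem[OF V(3) sub(2)]
      mem[OF V(3) sub(3)] mem[OF V(4) sub(1)] mem[OF V(4) sub(2)] mem[OF V(4) sub(3)]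
      eq[OF V(1,2)] eq[OF V(3,4)] eq[OF V(5,6)]\<close>)
qed

end

section \<open>Shapes with equal parameters are isomorphic\<close>

lemma bij_betw_two_points:
  assumes "finite A" "finite B" "card A = card B" "a \<in> A" "a' \<in> A" "a \<noteq> a'" "b \<in> B" "b' \<in> B" "b \<noteq> b'"
  shows "\<exists>f. bij_betw f A B \<and> f a = b \<and> f a' = b'"
proof -
  have "card (A - {a, a'}) = card (B - {b, b'})"
    using assms by (simp add: card_Diff_subset)
  then obtain g where "bij_betw g (A - {a, a'}) (B - {b, b'})"
    using finite_same_card_bij assms(1,2) by blast
  then have "bij_betw (\<lambda>z. if z = a then b else if z = a' then b' else g z) (A - {a, a'}) (B - {b, b'})"
    by (rule bij_betw_cong[THEN iffD1, rotated]) auto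
  moreover have "bij_betw (\<lambda>z. if z = a then b else if z = a' then b' else g z) {a, a'} {b, b'}"
    using assms by (auto simp: bij_betw_def inj_on_def)
  ultimately have "bij_betw (\<lambda>z. if z = a then b else if z = a' then b' else g z)
      ((A - {a, a'}) \<union> {a, a'}) ((B - {b, b'}) \<union> {b, b'})"
    by (rule bij_betw_combine) auto
  moreover have "(A - {a, a'}) \<union> {a, a'} = A" "(B - {b, b'}) \<union> {b, b'} = B" using assms by auto
  ultimately show ?thesis using assms(6) by (intro exI[of _ "\<lambda>z. if z = a then b else if z = a' then b' else g z"]) simp
qed

text \<open>The two hubs are interchangeable and so are the other vertices of each set: bijections
  of the three sets that match the hubs, extended to \<open>x\<close> and \<open>d\<close>, respect
  all edges.\<close>

lemma critical_shape_isomorphic: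
  assumes 1: "critical_shape H1 u1 u1' x1 d1 N1 R1 y1 y1'"
    and 2: "critical_shape H2 u2 u2' x2 d2 N2 R2 y2 y2'"
    and card: "card H1 = card H2" "card N1 = card N2" "card R1 = card R2" "y1 \<in> R1 \<longleftrightarrow> y2 \<in> R2"
  shows "\<exists>\<phi>. inj_on \<phi> (pverts (shape_graph H2 u2 u2' x2 d2 N2 R2 y2 y2')) \<and>
    shape_graph H1 u1 u1' x1 d1 N1 R1 y1 y1' = map_graph \<phi> (shape_graph H2 u2 u2' x2 d2 N2 R2 y2 y2')"
proof -
  interpret S1: critical_shape H1 u1 u1' x1 d1 N1 R1 y1 y1' by fact
  interpret S2: critical_shape H2 u2 u2' x2 d2 N2 R2 y2 y2' by fact
  note fin = S1.finite_sets S2.finite_sets and dj = S1.disjoint S2.disjoint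
  obtain f where f: "bij_betw f H2 H1" "f u2 = u1" "f u2' = u1'"
    using bij_betw_two_points[OF fin(4,1) card(1)[symmetric] S2.u S1.u] by blast
  \<comment> \<open>Only the set containing the hubs needs a bijection with two prescribed values;
    the other is mapped arbitrarily.\<close>
  have "\<exists>g h. bij_betw g N2 N1 \<and> bij_betw h R2 R1 \<and>
      (if y2 \<in> R2 then h y2 = y1 \<and> h y2' = y1' else g y2 = y1 \<and> g y2' = y1')"
  proof (cases "y2 \<in> R2")
    case True
    then have "y2' \<in> R2" "y1 \<in> R1" "y1' \<in> R1" using S1.y(2) S2.y(2) dj card(4) by auto
    then show ?thesis
      using True bij_betw_two_points[OF fin(6,3) card(3)[symmetric], of y2 y2' y1 y1'] S1.y(1) S2.y(1)
        finite_same_card_bij[OF fin(5,2) card(2)[symmetric]] by auto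
  next
    case False
    then have "y2 \<in> N2" "y2' \<in> N2" "y1 \<in> N1" "y1' \<in> N1" using S1.y(2) S2.y(2) card(4) by auto
    then show ?thesis
      using False bij_betw_two_points[OF fin(5,2) card(2)[symmetric], of y2 y2' y1 y1'] S1.y(1) S2.y(1)
        finite_same_card_bij[OF fin(6,3) card(3)[symmetric]] by auto
  qed
  then obtain g h where g: "bij_betw g N2 N1" and h: "bij_betw h R2 R1"
    and gh: "if y2 \<in> R2 then h y2 = y1 \<and> h y2' = y1' else g y2 = y1 \<and> g y2' = y1'"
    by blast
  define \<phi> where "\<phi> z = (if z \<in> H2 then f z else if z \<in> N2 then g z else if z \<in> R2 then h z
    else if z = x2 then x1 else d1)" for z
  have \<phi>H: "\<phi> z = f z" if "z \<in> H2" for z using that by (simp add: \<phi>_def)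
  have \<phi>N: "\<phi> z = g z" if "z \<in> N2" for z using that dj by (auto simp: \<phi>_def)
  have \<phi>R: "\<phi> z = h z" if "z \<in> R2" for z using that dj by (auto simp: \<phi>_def)
  have \<phi>x: "\<phi> x2 = x1" "\<phi> d2 = d1" using dj by (auto simp: \<phi>_def)
  have bij: "bij_betw \<phi> H2 H1" "bij_betw \<phi> N2 N1" "bij_betw \<phi> R2 R1"
    using f(1) g h \<phi>H \<phi>N \<phi>R by (simp_all cong: bij_betw_cong)
  have bij_xd: "bij_betw \<phi> {x2, d2} {x1, d1}" using dj \<phi>x by (auto simp: bij_betw_def inj_on_def)
  have "bij_betw \<phi> (H2 \<union> {x2, d2}) (H1 \<union> {x1, d1})"
    using dj by (intro bij_betw_combine[OF bij(1) bij_xd]) auto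
  then have "bij_betw \<phi> (H2 \<union> {x2, d2} \<union> N2) (H1 \<union> {x1, d1} \<union> N1)"
    using dj by (intro bij_betw_combine[OF _ bij(2)]) auto
  then have "bij_betw \<phi> (H2 \<union> {x2, d2} \<union> N2 \<union> R2) (H1 \<union> {x1, d1} \<union> N1 \<union> R1)"
    using dj by (intro bij_betw_combine[OF _ bij(3)]) auto
  then have inj: "inj_on \<phi> (pverts S2.K)" by (simp add: bij_betw_def)
  have "\<phi> y2 = y1" "\<phi> y2' = y1'"
    using gh \<phi>N \<phi>R S2.y(2) dj by (auto split: if_splits)
  moreover have "\<phi> u2 = u1" "\<phi> u2' = u1'" using f(2,3) \<phi>H S2.u by auto
  ultimately have "map_graph \<phi> S2.K = S1.K"
    using S2.map_graph_shape[OF inj] \<phi>x bij by (simp add: bij_betw_def)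
  then show ?thesis using inj by metis
qed

section \<open>Members of the families as shapes\<close>

lemma pverts_H_graph: "m \<noteq> 1 \<Longrightarrow> pverts (H_graph m) = (if m = 0 then {} else Inl ` {..<2} \<union> Inr ` {..<m - 2})"
  by (auto simp: H_graph_def edgeless_graph_def join_def complete_graph_def)

lemma finite_H_graph: "finite (pverts (H_graph m))"
  by (auto simp: H_graph_def edgeless_graph_def join_def complete_graph_def)

lemma card_H_graph:
  assumes "m = 0 \<or> m \<ge> 2"
  shows "card (pverts (H_graph m)) = m"
proof -
  have "card (Inl ` {..<2::nat} \<union> Inr ` {..<m - 2} :: (nat + nat) set) = 2 + (m - 2)"
    by (subst card_Un_disjoint) (auto simp: card_image)
  then show ?thesis using assms pverts_H_graph[of m] by auto
qed

lemma Inl_in_H_graph: "m \<ge> 2 \<Longrightarrow> Inl 0 \<in> pverts (H_graph m) \<and> Inl 1 \<in> pverts (H_graph m)"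
  using pverts_H_graph[of m] by auto

text \<open>Brings the join into the hub form used by \<open>shape_graph\<close>. For
  \<open>m = 0\<close> the product is empty although its first factor is not.\<close>

lemma parcs_H_graph:
  assumes "m = 0 \<or> m \<ge> 2"
  shows "parcs (H_graph m) = both_ways ({Inl 0, Inl 1} \<times> pverts (H_graph m)) - Id"
  using assms lessThan_nat_numeral[of "num.Bit0 num.One"]
  by (auto simp: H_graph_def edgeless_graph_def join_def complete_graph_def disjoint_union_def both_ways_def
      less_2_cases_iff)

lemma map_prod_parcs_H_graph:
  assumes "inj f" "m = 0 \<or> m \<ge> 2"
  shows "map_prod f f ` parcs (H_graph m) =
    both_ways ({f (Inl 0), f (Inl 1)} \<times> f ` pverts (H_graph m)) - Id"
proof -
  have "map_prod f f ` parcs (H_graph m) = both_ways (map_prod f f ` ({Inl 0, Inl 1} \<times> pverts (H_graph m))) - Id"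
    unfolding parcs_H_graph[OF assms(2)] by (rule map_prod_both_ways[OF assms(1)]) simp
  then show ?thesis by (simp add: map_prod_surj_on[OF refl refl])
qed

lemma both_ways_Un: "both_ways (A \<union> B) = both_ways A \<union> both_ways B"
  by (auto simp: both_ways_def)

lemma map_prod_image_both_ways: "map_prod f f ` both_ways S = both_ways (map_prod f f ` S)"
  unfolding both_ways_def by force

lemma both_ways_irreflexive: "(\<And>a. (a, a) \<notin> S) \<Longrightarrow> both_ways S - Id = both_ways S"
  by (auto simp: both_ways_def)

text \<open>For \<open>m = 0\<close> the set \<open>R\<close> is empty, and any two vertices of
  \<open>B\<close> serve as hubs since they have nothing to be joined to; this needs
  \<open>t \<ge> 2\<close>.\<close>

abbreviation F_hub :: "nat \<Rightarrow> nat \<Rightarrow> F_vertex" where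
  "F_hub m i \<equiv> (if m = 0 then FB i else FH1 (Inl i))"

text \<open>\<open>FV2\<close> plays \<open>x\<close> because \<open>H\<close> must contain two
  hubs, and only \<open>m2\<close> is at least 2 in every case.\<close>

lemma F_graph_eq_shape_graph:
  assumes "m1 = 0 \<or> m1 \<ge> 2" "m2 \<ge> 2"
  shows "F_graph m1 t m2 = shape_graph (FH2 ` pverts (H_graph m2)) (FH2 (Inl 0)) (FH2 (Inl 1)) FV2 FV1
    (FB ` {..<t}) (FH1 ` pverts (H_graph m1)) (F_hub m1 0) (F_hub m1 1)"
proof -
  have 1: "map_prod FH1 FH1 ` parcs (H_graph m1) =
      both_ways ({F_hub m1 0, F_hub m1 1} \<times> FH1 ` pverts (H_graph m1)) - Id"
  proof (cases "m1 = 0")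
    case True
    then show ?thesis by (simp add: H_graph_def edgeless_graph_def both_ways_def)
  next
    case False
    then show ?thesis using map_prod_parcs_H_graph[of FH1 m1] assms by (simp add: inj_def)
  qed
  have 2: "map_prod FH2 FH2 ` parcs (H_graph m2) =
      both_ways ({FH2 (Inl 0), FH2 (Inl 1)} \<times> FH2 ` pverts (H_graph m2)) - Id"
    using map_prod_parcs_H_graph[of FH2 m2] assms by (simp add: inj_def)
  let ?S = "{FV1} \<times> FH1 ` pverts (H_graph m1) \<union> {FV2} \<times> FH2 ` pverts (H_graph m2)
            \<union> {FV1, FV2} \<times> FB ` {..<t}"
  have 3: "both_ways ?S = both_ways ?S - Id"
    by (rule both_ways_irreflexive[symmetric]) auto
  have "{FV2} \<times> (FH2 ` pverts (H_graph m2) \<union> FB ` {..<t}) \<union>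
      {FV1} \<times> (FB ` {..<t} \<union> FH1 ` pverts (H_graph m1)) = ?S" by blast
  then show ?thesis
    unfolding F_graph_def shape_graph_def 1 2
    by (subst 3) (simp add: both_ways_Un Un_Diff Un_ac insert_commute)
qed

lemma critical_shape_F:
  assumes "t \<ge> 1" "m1 = 0 \<or> m1 \<ge> 2" "m2 \<ge> 2" "m1 = 0 \<longrightarrow> t \<ge> 2"
  shows "critical_shape (FH2 ` pverts (H_graph m2)) (FH2 (Inl 0)) (FH2 (Inl 1)) FV2 FV1
    (FB ` {..<t}) (FH1 ` pverts (H_graph m1)) (F_hub m1 0) (F_hub m1 1)"
proof
  show "F_hub m1 0 \<in> FH1 ` pverts (H_graph m1) \<and> F_hub m1 1 \<in> FH1 ` pverts (H_graph m1) \<and> FB ` {..<t} \<noteq> {} \<or>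
    F_hub m1 0 \<in> FB ` {..<t} \<and> F_hub m1 1 \<in> FB ` {..<t} \<and> (\<forall>r. FH1 ` pverts (H_graph m1) \<noteq> {r})"
    using assms Inl_in_H_graph[of m1] pverts_H_graph[of 0] by (auto simp: lessThan_empty_iff)
qed (use Inl_in_H_graph[OF assms(3)] finite_H_graph in auto)

text \<open>The apex of \<open>Q\<close> plays \<open>d\<close>. The hubs are \<open>a\<close> and
  \<open>b\<close>: besides the apex they are the only neighbours of the part of size
  \<open>s\<close>, and they lie in \<open>N\<close> because \<open>x\<close> is joined to
  them.\<close>

lemma F'_graph_eq_shape_graph:
  assumes "s \<ge> 2" "q \<ge> 2" "m \<ge> 2"
  shows "F'_graph s q m = shape_graph (FH ` pverts (H_graph m)) (FH (Inl 0)) (FH (Inl 1)) FX (FQ (Inl ()))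
    (FQ ` Inr ` (Inl ` Inl ` {..<2} \<union> Inr ` {..<q - 2})) (FQ ` Inr ` Inl ` Inr ` {..<s})
    (FQ (Inr (Inl (Inl 0)))) (FQ (Inr (Inl (Inl 1))))"
  (is "_ = shape_graph ?H ?u ?u' _ ?d ?N ?R ?y ?y'")
proof -
  have H: "map_prod FH FH ` parcs (H_graph m) = both_ways ({?u, ?u'} \<times> ?H) - Id"
    using map_prod_parcs_H_graph[of FH m] assms by (simp add: inj_def)
  have two: "{..<2::nat} = {0, 1}" by auto
  have "parcs (P_graph s q) = both_ways (Inl ` Inl ` {..<2} \<times> Inl ` Inr ` {..<s})"
    by (simp add: P_graph_def disjoint_union_def join_def edgeless_graph_def map_prod_image_both_ways
        map_prod_surj_on[OF refl refl])
  then have "parcs (Q_graph s q) = both_ways (Inr ` Inl ` Inl ` {..<2} \<times> Inr ` Inl ` Inr ` {..<s}) \<union>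
      both_ways ({Inl ()} \<times> Inr ` pverts (P_graph s q))"
    by (simp add: Q_graph_def join_def disjoint_union_def complete_graph_def map_prod_image_both_ways
        map_prod_surj_on[OF refl refl])
  then have "map_prod FQ FQ ` parcs (Q_graph s q) =
      both_ways (FQ ` Inr ` Inl ` Inl ` {..<2} \<times> ?R) \<union> both_ways ({?d} \<times> FQ ` Inr ` pverts (P_graph s q))"
    by (simp add: image_Un map_prod_image_both_ways map_prod_surj_on[OF refl refl])
  also have "FQ ` Inr ` Inl ` Inl ` {..<2} = {?y, ?y'}" by (simp add: two)
  also have V: "FQ ` Inr ` pverts (P_graph s q) = ?N \<union> ?R"
    unfolding P_graph_def disjoint_union_def join_def edgeless_graph_def
    by (simp add: Plus_def image_Un Un_ac)
  also have "both_ways ({?y, ?y'} \<times> ?R) \<union> both_ways ({?d} \<times> (?N \<union> ?R)) =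
      both_ways ({?d} \<times> (?N \<union> ?R) \<union> {?y, ?y'} \<times> ?R)"
    by (simp only: both_ways_Un Un_ac)
  also have "\<dots> = both_ways ({?d} \<times> (?N \<union> ?R) \<union> {?y, ?y'} \<times> ?R) - Id"
    by (rule both_ways_irreflexive[symmetric]) auto
  finally have Q: "map_prod FQ FQ ` parcs (Q_graph s q) = both_ways ({?d} \<times> (?N \<union> ?R) \<union> {?y, ?y'} \<times> ?R) - Id" .
  have X: "both_ways ({FX} \<times> (?H \<union> ?N)) = both_ways ({FX} \<times> (?H \<union> ?N)) - Id"
    by (rule both_ways_irreflexive[symmetric]) auto
  have "FQ ` pverts (Q_graph s q) = insert ?d (?N \<union> ?R)"
    using V by (simp add: Q_graph_def join_def complete_graph_def Plus_def image_Un)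
  then show ?thesis
    unfolding F'_graph_def shape_graph_def H Q
    by (subst X) (simp only: both_ways_Un Un_Diff Un_ac Un_insert_left Un_insert_right Un_empty_left Un_empty_right insert_commute)
qed

lemma critical_shape_F':
  assumes "s \<ge> 2" "q \<ge> 2" "m \<ge> 2"
  shows "critical_shape (FH ` pverts (H_graph m)) (FH (Inl 0)) (FH (Inl 1)) FX (FQ (Inl ()))
    (FQ ` Inr ` (Inl ` Inl ` {..<2} \<union> Inr ` {..<q - 2})) (FQ ` Inr ` Inl ` Inr ` {..<s})
    (FQ (Inr (Inl (Inl 0)))) (FQ (Inr (Inl (Inl 1))))"
  (is "critical_shape _ _ _ _ _ ?N ?R ?y ?y'")
proof
  have "card ?R = s" by (simp add: card_image inj_on_def)
  then have "?R \<noteq> {r}" for r using assms(1) card.insert[of "{}" r] by auto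
  moreover have "?y \<in> ?N" "?y' \<in> ?N" by simp_all
  ultimately show "?y \<in> ?R \<and> ?y' \<in> ?R \<and> ?N \<noteq> {} \<or> ?y \<in> ?N \<and> ?y' \<in> ?N \<and> (\<forall>r. ?R \<noteq> {r})"
    by (intro disjI2 conjI allI)
  show "?N \<inter> ?R = {}" by auto
qed (use Inl_in_H_graph[OF assms(3)] finite_H_graph in auto)

lemma family_imp_shape:
  assumes wf: "pair_wf_digraph G" and fam: "in_family_F G \<or> in_family_F' G"
  shows "\<exists>H u u' x d N R y y'. critical_shape H u u' x d N R y y' \<and> G = shape_graph H u u' x d N R y y'"
proof -
  have transport: ?thesis
    if S: "critical_shape H u u' x d N R y y'"
      and iso: "digraph_iso (with_proj G) (with_proj (shape_graph H u u' x d N R y y'))"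
    for H :: "'b set" and u u' x d N R y y'
  proof -
    interpret critical_shape H u u' x d N R y y' by fact
    obtain \<phi> where \<phi>: "inj_on \<phi> (pverts K)" "G = map_graph \<phi> K"
      using iso digraph_iso_with_proj_iff'[OF pair_wf_digraph_shape wf] by blast
    then show ?thesis using critical_shape_image[OF \<phi>(1)] map_graph_shape[OF \<phi>(1)] by metis
  qed
  from fam show ?thesis
  proof
    assume "in_family_F G"
    then obtain m1 t m2 where *: "t \<ge> 1" "m1 = 0 \<or> m1 \<ge> 2" "m2 \<ge> 2" "m1 = 0 \<longrightarrow> t \<ge> 2"
      "digraph_iso (with_proj G) (with_proj (F_graph m1 t m2))"
      unfolding in_family_F_def by blast
    show ?thesis
      using transport[OF critical_shape_F[OF *(1-4)]] *(5) F_graph_eq_shape_graph[OF *(2,3)] by simp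
  next
    assume "in_family_F' G"
    then obtain s q m where *: "s \<ge> 2" "q \<ge> 2" "m \<ge> 2"
      "digraph_iso (with_proj G) (with_proj (F'_graph s q m))"
      unfolding in_family_F'_def by blast
    show ?thesis
      using transport[OF critical_shape_F'[OF *(1-3)]] *(4) F'_graph_eq_shape_graph[OF *(1-3)] by simp
  qed
qed

section \<open>Locating a shape in the families\<close>

lemma card_ge_2I: "finite A \<Longrightarrow> a \<in> A \<Longrightarrow> b \<in> A \<Longrightarrow> a \<noteq> b \<Longrightarrow> card A \<ge> 2"
  using card_mono[of A "{a, b}"] by simp

context critical_shape
begin

lemma isomorphic_F:
  assumes "y \<in> R \<or> R = {}"
  shows "digraph_iso (with_proj K) (with_proj (F_graph (card R) (card N) (card H)))"
    and "card R = 0 \<or> card R \<ge> 2" "card N \<ge> 1" "card R = 0 \<longrightarrow> card N \<ge> 2"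
proof -
  show R: "card R = 0 \<or> card R \<ge> 2"
    using assms y card_ge_2I[OF finite_sets(3), of y y'] disjoint by auto
  show N: "card N \<ge> 1" using N_nonempty finite_sets(2) by (simp add: Suc_leI card_gt_0_iff)
  show N2: "card R = 0 \<longrightarrow> card N \<ge> 2"
    using y card_ge_2I[OF finite_sets(2), of y y'] finite_sets(3) by auto
  have H: "card H \<ge> 2" using card_ge_2I[OF finite_sets(1)] u by blast
  note F = critical_shape_F[OF N R H N2]
  have "y \<in> R \<longleftrightarrow> card R \<noteq> 0" using assms finite_sets(3) by auto
  also have "\<dots> \<longleftrightarrow> F_hub (card R) 0 \<in> FH1 ` pverts (H_graph (card R))"
    using R Inl_in_H_graph[of "card R"] pverts_H_graph[of 0] by auto
  finally have mem: "y \<in> R \<longleftrightarrow> F_hub (card R) 0 \<in> FH1 ` pverts (H_graph (card R))" .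
  have "card (FH2 ` pverts (H_graph (card H))) = card H" "card (FB ` {..<card N}) = card N"
    "card (FH1 ` pverts (H_graph (card R))) = card R"
    using R H by (simp_all add: card_image inj_on_def card_H_graph)
  then obtain \<phi> where "inj_on \<phi> (pverts (F_graph (card R) (card N) (card H)))"
    "K = map_graph \<phi> (F_graph (card R) (card N) (card H))"
    using critical_shape_isomorphic[OF critical_shape_axioms F _ _ _ mem]
    unfolding F_graph_eq_shape_graph[OF R H, symmetric] by auto
  then show "digraph_iso (with_proj K) (with_proj (F_graph (card R) (card N) (card H)))"
    using digraph_iso_with_proj_iff'[OF critical_shape.pair_wf_digraph_shape[OF F] pair_wf_digraph_shape]
    unfolding F_graph_eq_shape_graph[OF R H, symmetric] by blast
qed

lemma isomorphic_F':
  assumes "y \<notin> R" "R \<noteq> {}"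
  shows "digraph_iso (with_proj K) (with_proj (F'_graph (card R) (card N) (card H)))"
    and "card R \<ge> 2" "card N \<ge> 2" "card H \<ge> 2"
proof -
  obtain r where r: "r \<in> R" using assms by blast
  then obtain r' where "r' \<in> R" "r' \<noteq> r" using assms y(2) by blast
  then show R: "card R \<ge> 2" using r card_ge_2I[OF finite_sets(3)] by blast
  show N: "card N \<ge> 2" using assms y card_ge_2I[OF finite_sets(2)] by blast
  show H: "card H \<ge> 2" using card_ge_2I[OF finite_sets(1)] u by blast
  note F = critical_shape_F'[OF R N H]
  have "card (Inl ` Inl ` {..<2} \<union> Inr ` {..<card N - 2} :: ((nat + nat) + nat) set) = 2 + (card N - 2)"
    by (subst card_Un_disjoint) (auto simp: card_image inj_on_def)
  then have "card (FQ ` Inr ` (Inl ` Inl ` {..<2} \<union> Inr ` {..<card N - 2})) = card N"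
    using N by (simp add: card_image inj_on_def)
  moreover have "card (FH ` pverts (H_graph (card H))) = card H"
    "card (FQ ` Inr ` Inl ` Inr ` {..<card R}) = card R"
    using H by (simp_all add: card_image inj_on_def card_H_graph)
  moreover have "y \<in> R \<longleftrightarrow> FQ (Inr (Inl (Inl 0))) \<in> FQ ` Inr ` Inl ` Inr ` {..<card R}"
    using assms by auto
  ultimately obtain \<phi> where "inj_on \<phi> (pverts (F'_graph (card R) (card N) (card H)))"
    "K = map_graph \<phi> (F'_graph (card R) (card N) (card H))"
    using critical_shape_isomorphic[OF critical_shape_axioms F]
    unfolding F'_graph_eq_shape_graph[OF R N H, symmetric] by metis
  then show "digraph_iso (with_proj K) (with_proj (F'_graph (card R) (card N) (card H)))"
    using digraph_iso_with_proj_iff'[OF critical_shape.pair_wf_digraph_shape[OF F] pair_wf_digraph_shape]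
    unfolding F'_graph_eq_shape_graph[OF R N H, symmetric] by blast
qed

text \<open>Membership in \<open>in_family_F\<close> needs ordered parameters. \<open>R\<close> can
  have more vertices than \<open>H\<close> in that case only if it contains the hubs, and then
  \<open>swap\<close> applies.\<close>

lemma family_shape: "in_family_F K \<or> in_family_F' K"
proof -
  have H: "card H \<ge> 2" using card_ge_2I[OF finite_sets(1)] u by blast
  consider "y \<in> R \<or> R = {}" "card R \<le> card H" | "y \<in> R" "card H \<le> card R" | "y \<notin> R" "R \<noteq> {}"
    by (cases "R = {}"; cases "y \<in> R"; cases "card R \<le> card H") auto
  then show ?thesis
  proof cases
    case 1
    have "in_family_F K"
      unfolding in_family_F_def
      by (rule exI[of _ "card R"], rule exI[of _ "card N"], rule exI[of _ "card H"])
        (use isomorphic_F[OF 1(1)] H 1(2) in simp)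
    then show ?thesis ..
  next
    case 2
    interpret S: critical_shape R y y' d x N H u u' by (rule swap[OF 2(1)])
    have iso: "digraph_iso (with_proj K) (with_proj (F_graph (card H) (card N) (card R)))"
      using S.isomorphic_F(1) u(1) unfolding shape_graph_swap by blast
    have "in_family_F K"
      unfolding in_family_F_def
      by (rule exI[of _ "card H"], rule exI[of _ "card N"], rule exI[of _ "card R"])
        (use iso isomorphic_F(3) 2 H in simp)
    then show ?thesis ..
  next
    case 3
    have "in_family_F' K"
      unfolding in_family_F'_def
      by (rule exI[of _ "card R"], rule exI[of _ "card N"], rule exI[of _ "card H"])
        (use isomorphic_F'[OF 3] in simp)
    then show ?thesis ..
  qed
qed

end

section \<open>Critical graphs with a cut-vertex\<close>

text \<open>A walk from \<open>A\<close> to the outside has a step leaving \<open>A\<close>;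
  conversely, the set of vertices reachable from a given one has no step leaving it. In this form,
  disconnectedness of \<open>G - x\<close> yields the two sides and connectedness of
  \<open>G\<close> yields neighbours of \<open>x\<close> in both.\<close>

lemma connected_iff_crossing:
  assumes "wf_digraph K"
  shows "Digraph_Component.connected K \<longleftrightarrow> verts K \<noteq> {} \<and>
    (\<forall>A. A \<noteq> {} \<and> A \<subset> verts K \<longrightarrow> (\<exists>a \<in> A. \<exists>b \<in> verts K - A. (a, b) \<in> (arcs_ends K)\<^sup>s))"
    (is "_ \<longleftrightarrow> _ \<and> (\<forall>A. ?proper A \<longrightarrow> ?crossed A)")
proof (intro iffI conjI allI impI)
  assume "Digraph_Component.connected K"
  then show "verts K \<noteq> {}" by (simp add: connected_conv)
next
  fix A assume conn: "Digraph_Component.connected K" and A: "?proper A"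
  then obtain a b where ab: "a \<in> A" "b \<in> verts K - A" by blast
  then have "(a, b) \<in> rtrancl_on (verts K) ((arcs_ends K)\<^sup>s)"
    using conn A by (auto simp: connected_conv)
  then have "b \<in> A \<or> ?crossed A"
  proof (induction rule: rtrancl_on_induct)
    case base
    then show ?case using ab(1) by blast
  next
    case (step v w)
    then show ?case by blast
  qed
  then show "?crossed A" using ab(2) by blast
next
  assume *: "verts K \<noteq> {} \<and> (\<forall>A. ?proper A \<longrightarrow> ?crossed A)"
  show "Digraph_Component.connected K"
    unfolding connected_conv
  proof (intro conjI ballI)
    fix v w assume v: "v \<in> verts K" and w: "w \<in> verts K"
    define A where "A = {z. (v, z) \<in> rtrancl_on (verts K) ((arcs_ends K)\<^sup>s)}"
    have "v \<in> A" using v unfolding A_def by simp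
    have "A \<subseteq> verts K" unfolding A_def by (auto intro: in_rtrancl_on_in_F)
    have "\<not> ?crossed A"
      unfolding A_def by (auto intro: rtrancl_on_into_rtrancl_on)
    then have "A = verts K" using * \<open>v \<in> A\<close> \<open>A \<subseteq> verts K\<close> by blast
    then show "(v, w) \<in> rtrancl_on (verts K) ((arcs_ends K)\<^sup>s)" using w unfolding A_def by blast
  qed (use * in blast)
qed

section \<open>Criticality as edge-minimality\<close>

lemma mb_critical_2_two_move_win:
  assumes "finite (pverts G)" "mb_critical 2 G"
  shows "two_move_win G" "e \<in> parcs G \<Longrightarrow> \<not> two_move_win (delete_edge G e)"
  using assms mb_critical_2_iff by blast+

text \<open>Winning is monotone in the edges, so an edge outside \<open>K\<close> could be deleted
  from \<open>G\<close> without harm. Symmetry matters because \<open>delete_edge\<close> removes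
  both arcs.\<close>

lemma mb_critical_2_spanning_subgraph:
  assumes "finite (pverts G)" "mb_critical 2 G" "pverts K = pverts G" "parcs K \<subseteq> parcs G" "sym (parcs K)"
    "two_move_win K"
  shows "parcs K = parcs G"
proof (rule ccontr)
  assume "parcs K \<noteq> parcs G"
  then obtain e where e: "e \<in> parcs G" "e \<notin> parcs K" using assms(4) by blast
  then have "prod.swap e \<notin> parcs K" using assms(5) by (cases e) (auto dest: symD)
  then have "parcs K \<subseteq> parcs (delete_edge G e)" using e(2) assms(4) by (auto simp: delete_edge_def)
  then have "two_move_win (delete_edge G e)"
    using two_move_win_mono[OF assms(6)] assms(3) by (simp add: delete_edge_def)
  then show False using mb_critical_2_two_move_win(2)[OF assms(1,2) e(1)] by blast
qed

text \<open>A critical graph may at this stage still have a dominating vertex: not winning in one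
  move only excludes two of them. If \<open>p\<close> dominates alone, any two further vertices
  complete it to pairs, and four vertices leave two besides \<open>s\<close> and
  \<open>p\<close>.\<close>

lemma two_move_win_obtain:
  assumes win: "two_move_win G" and fin: "finite (pverts G)" and card: "card (pverts G) \<ge> 4"
    and s: "s \<in> pverts G"
  obtains p q q' where "p \<noteq> s" "q \<noteq> s" "q' \<noteq> s" "p \<noteq> q" "p \<noteq> q'" "q \<noteq> q'"
    "dominating_set G {p, q}" "dominating_set G {p, q'}"
proof -
  obtain p where p: "p \<in> pverts G - {s}" "dominating_set G {p} \<or>
     (\<exists>q q'. q \<noteq> q' \<and> q \<notin> {s, p} \<and> q' \<notin> {s, p} \<and>
        dominating_set G {p, q} \<and> dominating_set G {p, q'})"
    using win s unfolding two_move_win_def by blast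
  show thesis
  proof (cases "dominating_set G {p}")
    case True
    define S where "S = pverts G - {s, p}"
    have "card S = card (pverts G) - card {s, p}"
      using p(1) s unfolding S_def by (intro card_Diff_subset) auto
    moreover have "card {s, p} = 2" using p(1) by (simp add: eq_commute)
    ultimately have "\<not> card S \<le> Suc 0" using card by linarith
    moreover have "finite S" using fin by (simp add: S_def)
    ultimately obtain q q' where "q \<in> S" "q' \<in> S" "q \<noteq> q'"
      using card_le_Suc0_iff_eq by metis
    then have q: "q \<in> pverts G" "q \<notin> {s, p}" "q' \<in> pverts G" "q' \<notin> {s, p}" "q \<noteq> q'"
      by (auto simp: S_def)
    have dom: "dominating_set G {p, z}" if "z \<in> pverts G" for z
      using dominating_set_superset[OF True, of "{p, z}"] that p(1) by simp
    show thesis using that[of p q q'] dom q p(1) by auto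
  next
    case False
    then obtain q q' where "q \<noteq> q'" "q \<notin> {s, p}" "q' \<notin> {s, p}" "dominating_set G {p, q}" "dominating_set G {p, q'}"
      using p by blast
    then show thesis using that[of p q q'] p(1) by auto
  qed
qed

text \<open>Dominator answers inside Staller's part with a vertex dominating that part, and both
  such vertices of the other part remain as threats. Edges between the parts never enter.\<close>

lemma two_move_win_disjoint:
  assumes "pverts G = S \<union> T" "S \<inter> T = {}"
    and S: "a \<in> S" "a' \<in> S" "a \<noteq> a'" "\<And>v. v \<in> S \<Longrightarrow> v = a \<or> (v, a) \<in> parcs G" "\<And>v. v \<in> S \<Longrightarrow> v = a' \<or> (v, a') \<in> parcs G"
    and T: "b \<in> T" "b' \<in> T" "b \<noteq> b'" "\<And>v. v \<in> T \<Longrightarrow> v = b \<or> (v, b) \<in> parcs G" "\<And>v. v \<in> T \<Longrightarrow> v = b' \<or> (v, b') \<in> parcs G"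
  shows "two_move_win G"
proof -
  have dom: "dominating_set G {p, q}" "dominating_set G {q, p}" if "p \<in> {a, a'}" "q \<in> {b, b'}" for p q
    using that S T assms(1) unfolding dominating_set_pair_iff by blast+
  have reply: "\<exists>p \<in> pverts G - {s}. dominating_set G {p} \<or> (\<exists>q q'. q \<noteq> q' \<and> q \<notin> {s, p} \<and> q' \<notin> {s, p} \<and>
        dominating_set G {p, q} \<and> dominating_set G {p, q'})"
    if "{p, q, q'} \<subseteq> pverts G - {s}" "p \<noteq> q" "p \<noteq> q'" "q \<noteq> q'"
      "dominating_set G {p, q}" "dominating_set G {p, q'}" for s p q q'
    using that by (intro bexI[of _ p] disjI2 exI[of _ q] exI[of _ q']) auto
  have ne: "a \<noteq> b" "a \<noteq> b'" "a' \<noteq> b" "a' \<noteq> b'" using assms(2) S(1,2) T(1,2) by blast+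
  show ?thesis
    unfolding two_move_win_def
  proof
    fix s assume "s \<in> pverts G"
    then consider "s \<in> S" "s \<noteq> a" | "s \<in> S" "s \<noteq> a'" | "s \<in> T" "s \<noteq> b" | "s \<in> T" "s \<noteq> b'"
      using assms(1) S(3) T(3) by blast
    then show "\<exists>p \<in> pverts G - {s}. dominating_set G {p} \<or> (\<exists>q q'. q \<noteq> q' \<and> q \<notin> {s, p} \<and> q' \<notin> {s, p} \<and>
        dominating_set G {p, q} \<and> dominating_set G {p, q'})"
    proof cases
      case 1
      then have "{a, b, b'} \<subseteq> pverts G - {s}" using assms(1,2) S(1) T(1,2) by blast
      then show ?thesis using dom ne T(3) by (intro reply[of a b b']) simp_all
    next
      case 2
      then have "{a', b, b'} \<subseteq> pverts G - {s}" using assms(1,2) S(2) T(1,2) by blast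
      then show ?thesis using dom ne T(3) by (intro reply[of a' b b']) simp_all
    next
      case 3
      then have "{b, a, a'} \<subseteq> pverts G - {s}" using assms(1,2) S(1,2) T(1) by blast
      then show ?thesis using dom ne ne[symmetric] S(3) by (intro reply[of b a a']) simp_all
    next
      case 4
      then have "{b', a, a'} \<subseteq> pverts G - {s}" using assms(1,2) S(1,2) T(2) by blast
      then show ?thesis using dom ne ne[symmetric] S(3) by (intro reply[of b' a a']) simp_all
    qed
  qed
qed

section \<open>The structure around a cut-vertex\<close>

definition universal :: "'a pair_pre_digraph \<Rightarrow> 'a set \<Rightarrow> 'a set" where
  "universal G S = {z \<in> S. \<forall>v \<in> S. v = z \<or> (v, z) \<in> parcs G}"

text \<open>Each side is a union of components of \<open>G - x\<close>. Nothing distinguishes the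
  sides, so every argument can be used with \<open>A\<close> and \<open>B\<close> exchanged.\<close>

locale critical_cut =
  fixes G :: "'a pair_pre_digraph" and A B :: "'a set" and x :: 'a
  assumes graph: "pair_graph G" and critical: "mb_critical 2 G"
    and pverts_eq: "pverts G = A \<union> B \<union> {x}"
    and disj: "A \<inter> B = {}" "x \<notin> A" "x \<notin> B"
    and no_arcs: "\<And>a b. a \<in> A \<Longrightarrow> b \<in> B \<Longrightarrow> (a, b) \<notin> parcs G"
    and neighbour: "\<exists>a \<in> A. (a, x) \<in> parcs G" "\<exists>b \<in> B. (b, x) \<in> parcs G"
begin

lemma arcs_sym: "(v, w) \<in> parcs G \<Longrightarrow> (w, v) \<in> parcs G"
proof -
  interpret pair_graph G by (rule graph)
  show "(v, w) \<in> parcs G \<Longrightarrow> (w, v) \<in> parcs G" by (rule arcs_symmetric)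
qed

lemma finite_pverts: "finite (pverts G)"
proof -
  interpret pair_graph G by (rule graph)
  show ?thesis by (rule pair_finite_verts)
qed

lemma no_arcs': "a \<in> A \<Longrightarrow> b \<in> B \<Longrightarrow> (b, a) \<notin> parcs G"
  using no_arcs arcs_sym by blast

lemma swap: "critical_cut G B A x"
proof (rule critical_cut.intro)
qed (use graph critical pverts_eq disj no_arcs' neighbour in auto)

text \<open>Two vertices on the same side would leave the other, nonempty side undominated; so each
  vertex has to dominate its own side alone.\<close>

lemma dominating_pair_cases:
  assumes "dominating_set G {p, q}" "p \<noteq> x" "q \<noteq> x"
  shows "p \<in> universal G A \<and> q \<in> universal G B \<or> q \<in> universal G A \<and> p \<in> universal G B"
    and "(p, x) \<in> parcs G \<or> (q, x) \<in> parcs G"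
proof -
  have dom: "v = p \<or> v = q \<or> (v, p) \<in> parcs G \<or> (v, q) \<in> parcs G" if "v \<in> A \<union> B \<union> {x}" for v
    using assms(1) that pverts_eq unfolding dominating_set_pair_iff by blast
  show "(p, x) \<in> parcs G \<or> (q, x) \<in> parcs G"
    using dom[of x] assms(2,3) arcs_sym by auto
  have pq: "p \<in> A \<union> B" "q \<in> A \<union> B"
    using assms pverts_eq unfolding dominating_set_pair_iff by auto
  obtain a b where ab: "a \<in> A" "b \<in> B" using neighbour by blast
  have uni: "p \<in> universal G A \<and> q \<in> universal G B"
    if "p \<in> A" "q \<in> B" "\<And>v. v \<in> A \<union> B \<Longrightarrow> v = p \<or> v = q \<or> (v, p) \<in> parcs G \<or> (v, q) \<in> parcs G" for p q
    using that disj no_arcs no_arcs' unfolding universal_def by blast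
  consider "p \<in> A" "q \<in> B" | "p \<in> B" "q \<in> A" | "p \<in> A" "q \<in> A" | "p \<in> B" "q \<in> B"
    using pq by blast
  then show "p \<in> universal G A \<and> q \<in> universal G B \<or> q \<in> universal G A \<and> p \<in> universal G B"
  proof cases
    case 1
    then show ?thesis using uni[of p q] dom by blast
  next
    case 2
    then show ?thesis using uni[of q p] dom by blast
  next
    case 3
    then show ?thesis using dom[of b] ab no_arcs' disj by blast
  next
    case 4
    then show ?thesis using dom[of a] ab no_arcs disj by blast
  qed
qed

lemma dominating_pair_x:
  assumes "dominating_set G {x, z}" "z \<in> A"
  shows "b \<in> B \<Longrightarrow> (b, x) \<in> parcs G" "v \<in> A \<Longrightarrow> v = z \<or> (v, x) \<in> parcs G \<or> (v, z) \<in> parcs G"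
proof -
  have dom: "v = x \<or> v = z \<or> (v, x) \<in> parcs G \<or> (v, z) \<in> parcs G" if "v \<in> A \<union> B" for v
    using assms(1) that pverts_eq unfolding dominating_set_pair_iff by blast
  show "b \<in> B \<Longrightarrow> (b, x) \<in> parcs G" using dom[of b] assms(2) no_arcs' disj by blast
  show "v \<in> A \<Longrightarrow> v = z \<or> (v, x) \<in> parcs G \<or> (v, z) \<in> parcs G" using dom[of v] disj by blast
qed

text \<open>
  Otherwise an edge between \<open>x\<close> and \<open>B\<close> is superfluous: Dominator still wins by answering Staller's first
  move with one of \<open>a, a', b, b'\<close> in the same part, and then needs only one of the two in the other part.
\<close>

lemma not_two_universal:
  assumes a: "a \<in> A \<union> {x}" "a' \<in> A \<union> {x}" "a \<noteq> a'"
      "\<And>v. v \<in> A \<union> {x} \<Longrightarrow> v = a \<or> (v, a) \<in> parcs G" "\<And>v. v \<in> A \<union> {x} \<Longrightarrow> v = a' \<or> (v, a') \<in> parcs G"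
    and b: "b \<in> universal G B" "b' \<in> universal G B" "b \<noteq> b'"
  shows False
proof -
  obtain z where z: "z \<in> B" "(z, x) \<in> parcs G" using neighbour by blast
  let ?D = "delete_edge G (z, x)"
  have in_A: "(v, w) \<in> parcs ?D" if "(v, w) \<in> parcs G" "v \<in> A \<union> {x}" "w \<in> A \<union> {x}" for v w
    using that z(1) disj by (auto simp: delete_edge_def)
  have in_B: "(v, w) \<in> parcs ?D" if "(v, w) \<in> parcs G" "v \<in> B" "w \<in> B" for v w
    using that disj by (auto simp: delete_edge_def)
  have "two_move_win ?D"
  proof (rule two_move_win_disjoint)
    show "pverts ?D = (A \<union> {x}) \<union> B" using pverts_eq by (auto simp: delete_edge_def)
    show "(A \<union> {x}) \<inter> B = {}" using disj by blast
    show "v = a \<or> (v, a) \<in> parcs ?D" if "v \<in> A \<union> {x}" for v using a(1,4) in_A that by blast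
    show "v = a' \<or> (v, a') \<in> parcs ?D" if "v \<in> A \<union> {x}" for v using a(2,5) in_A that by blast
    show "v = b \<or> (v, b) \<in> parcs ?D" if "v \<in> B" for v using b(1) in_B that unfolding universal_def by blast
    show "v = b' \<or> (v, b') \<in> parcs ?D" if "v \<in> B" for v using b(2) in_B that unfolding universal_def by blast
  qed (use a b in \<open>auto simp: universal_def\<close>)
  then show False using mb_critical_2_two_move_win(2)[OF finite_pverts critical z(2)] by blast
qed

text \<open>A universal vertex of \<open>A\<close> that is adjacent to \<open>x\<close> is universal
  in \<open>A \<union> {x}\<close>.\<close>

lemma unique_universal_neighbour:
  assumes "a \<in> universal G A" "a' \<in> universal G A" "(a, x) \<in> parcs G" "(a', x) \<in> parcs G"
    and b: "b \<in> universal G B" "b' \<in> universal G B" "b \<noteq> b'"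
  shows "a = a'"
proof (rule ccontr)
  assume "a \<noteq> a'"
  then show False
    using not_two_universal[of a a' b b'] assms arcs_sym unfolding universal_def by blast
qed

text \<open>The centre of the shape is named \<open>z\<close> because it can differ from the
  cut-vertex \<open>x\<close> of the locale.\<close>

lemma eq_shape_graph:
  assumes shape: "critical_shape H u u' z d N R y y'"
    and V: "pverts G = H \<union> {z, d} \<union> N \<union> R"
    and "\<And>h. h \<in> H \<Longrightarrow> (z, h) \<in> parcs G" "\<And>n. n \<in> N \<Longrightarrow> (z, n) \<in> parcs G"
      "\<And>n. n \<in> N \<Longrightarrow> (d, n) \<in> parcs G" "\<And>r. r \<in> R \<Longrightarrow> (d, r) \<in> parcs G"
      "\<And>h. h \<in> H \<Longrightarrow> h \<noteq> u \<Longrightarrow> (u, h) \<in> parcs G" "\<And>h. h \<in> H \<Longrightarrow> h \<noteq> u' \<Longrightarrow> (u', h) \<in> parcs G"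
      "\<And>r. r \<in> R \<Longrightarrow> r \<noteq> y \<Longrightarrow> (y, r) \<in> parcs G" "\<And>r. r \<in> R \<Longrightarrow> r \<noteq> y' \<Longrightarrow> (y', r) \<in> parcs G"
  shows "G = shape_graph H u u' z d N R y y'"
proof -
  interpret critical_shape H u u' z d N R y y' by (rule shape)
  let ?S = "{z} \<times> (H \<union> N) \<union> {d} \<times> (N \<union> R) \<union> {u, u'} \<times> H \<union> {y, y'} \<times> R"
  have arc: "(v, w) \<in> parcs G" if vw: "(v, w) \<in> ?S" and "v \<noteq> w" for v w
  proof -
    consider "v = z" "w \<in> H" | "v = z" "w \<in> N" | "v = d" "w \<in> N" | "v = d" "w \<in> R"
      | "v = u" "w \<in> H" | "v = u'" "w \<in> H" | "v = y" "w \<in> R" | "v = y'" "w \<in> R"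
      using vw by blast
    then show ?thesis using assms(3-10)[of w] \<open>v \<noteq> w\<close> by cases simp_all
  qed
  have "parcs K \<subseteq> parcs G"
  proof
    fix e assume "e \<in> parcs K"
    then have "fst e \<noteq> snd e" "(fst e, snd e) \<in> ?S \<or> (snd e, fst e) \<in> ?S"
      unfolding shape_graph_def both_ways_def by (cases e; simp; blast)+
    then show "e \<in> parcs G"
      using arc[of "fst e" "snd e"] arc[of "snd e" "fst e"] arcs_sym[of "snd e" "fst e"] by auto
  qed
  moreover have "sym (parcs K)" unfolding shape_graph_def both_ways_def by (auto intro: symI)
  ultimately have "parcs K = parcs G"
    using V by (intro mb_critical_2_spanning_subgraph[OF finite_pverts critical _ _ _ two_move_win_shape]) simp_all
  then show ?thesis using V by (intro pair_pre_digraph.equality) simp_all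
qed

text \<open>Each side has exactly one universal vertex adjacent to \<open>x\<close>:
  \<open>d\<close> in \<open>A\<close> and some \<open>p\<close> in \<open>B\<close>. Staller's
  moves \<open>d\<close> and \<open>p\<close> each call for two further universal vertices on the
  side of the move. The result is a shape with \<open>N = {x}\<close>, centred at \<open>p\<close>
  and \<open>d\<close>.\<close>

lemma shape_if_two_universal:
  assumes d: "d \<in> universal G A" "d' \<in> universal G A" "d \<noteq> d'" "(d, x) \<in> parcs G"
    and u: "u \<in> universal G B" "u' \<in> universal G B" "u \<noteq> u'"
    and card: "card (pverts G) \<ge> 4"
  shows "\<exists>H u u' z d N R y y'. critical_shape H u u' z d N R y y' \<and> G = shape_graph H u u' z d N R y y'"
proof -
  interpret S: critical_cut G B A x by (rule swap)
  have sub: "universal G A \<subseteq> A" "universal G B \<subseteq> B" unfolding universal_def by auto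
  note uniqueA = unique_universal_neighbour[OF _ _ _ _ u]
  note uniqueB = S.unique_universal_neighbour[OF _ _ _ _ d(1-3)]
  note win = two_move_win_obtain[OF mb_critical_2_two_move_win(1)[OF finite_pverts critical] finite_pverts card]
  \<comment> \<open>A pair containing \<open>x\<close> would need \<open>x\<close> adjacent to all
    of one side, hence to two universal vertices of that side.\<close>
  have not_x: "\<not> dominating_set G {x, z}" if "z \<noteq> x" for z
  proof
    assume dom: "dominating_set G {x, z}"
    then have "z \<in> A \<or> z \<in> B" using that pverts_eq unfolding dominating_set_pair_iff by blast
    then show False
    proof
      assume "z \<in> A"
      then show False using dominating_pair_x(1)[OF dom] uniqueB[OF u(1,2)] u sub by blast
    next
      assume "z \<in> B"
      then show False using S.dominating_pair_x(1)[OF dom] uniqueA[OF d(1,2)] d sub by blast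
    qed
  qed
  then have not_x': "p \<noteq> x \<and> q \<noteq> x" if "dominating_set G {p, q}" "p \<noteq> q" for p q
    using that by (metis insert_commute)
  have "d \<in> pverts G" using d(1) sub pverts_eq by blast
  then obtain p q q' where p: "p \<noteq> d" "q \<noteq> d" "q' \<noteq> d" "p \<noteq> q" "p \<noteq> q'" "q \<noteq> q'"
    "dominating_set G {p, q}" "dominating_set G {p, q'}"
    using win by metis
  \<comment> \<open>With \<open>d\<close> taken, no remaining universal vertex of \<open>A\<close>
    sees \<open>x\<close>, so the partner in \<open>B\<close> has to.\<close>
  have nx: "(a, x) \<notin> parcs G" if "a \<in> universal G A" "a \<noteq> d" for a
    using uniqueA[OF that(1) d(1)] that(2) d(4) by blast
  have p_cases: "p \<in> universal G A \<and> r \<in> universal G B \<and> (r, x) \<in> parcs G \<or>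
      r \<in> universal G A \<and> p \<in> universal G B \<and> (p, x) \<in> parcs G" if "r \<in> {q, q'}" for r
  proof -
    have r: "dominating_set G {p, r}" "p \<noteq> r" "r \<noteq> d" using that p by auto
    have "p \<noteq> x" "r \<noteq> x" using not_x'[OF r(1,2)] by auto
    from dominating_pair_cases[OF r(1) this] show ?thesis using nx p(1) r(3) by blast
  qed
  \<comment> \<open>Otherwise \<open>q\<close> and \<open>q'\<close> would be two universal vertices
    of \<open>B\<close> adjacent to \<open>x\<close>.\<close>
  have "p \<notin> universal G A"
  proof
    assume "p \<in> universal G A"
    then have "p \<notin> universal G B" using sub disj by blast
    then have "q \<in> universal G B" "q' \<in> universal G B" "(q, x) \<in> parcs G" "(q', x) \<in> parcs G"
      using p_cases[of q] p_cases[of q'] by auto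
    then show False using uniqueB p(6) by blast
  qed
  then have w: "p \<in> universal G B" "(p, x) \<in> parcs G" "q \<in> universal G A" "q' \<in> universal G A"
    using p_cases[of q] p_cases[of q'] by auto
  have "p \<in> pverts G" using w(1) sub pverts_eq by blast
  then obtain p2 q2 q2' where p2: "p2 \<noteq> p" "q2 \<noteq> p" "q2' \<noteq> p" "p2 \<noteq> q2" "p2 \<noteq> q2'" "q2 \<noteq> q2'"
    "dominating_set G {p2, q2}" "dominating_set G {p2, q2'}"
    using win by metis
  have nx2: "(a, x) \<notin> parcs G" if "a \<in> universal G B" "a \<noteq> p" for a
    using uniqueB[OF that(1) w(1)] that(2) w(2) by blast
  have p2_cases: "p2 \<in> universal G B \<and> r \<in> universal G A \<and> (r, x) \<in> parcs G \<or>
      r \<in> universal G B \<and> p2 \<in> universal G A \<and> (p2, x) \<in> parcs G" if "r \<in> {q2, q2'}" for r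
  proof -
    have r: "dominating_set G {p2, r}" "p2 \<noteq> r" "r \<noteq> p" using that p2 by auto
    have "p2 \<noteq> x" "r \<noteq> x" using not_x'[OF r(1,2)] by auto
    from dominating_pair_cases[OF r(1) this] show ?thesis using nx2 p2(1) r(3) by blast
  qed
  have "p2 \<notin> universal G B"
  proof
    assume "p2 \<in> universal G B"
    then have "p2 \<notin> universal G A" using sub disj by blast
    then have "q2 \<in> universal G A" "q2' \<in> universal G A" "(q2, x) \<in> parcs G" "(q2', x) \<in> parcs G"
      using p2_cases[of q2] p2_cases[of q2'] by auto
    then show False using uniqueA p2(6) by blast
  qed
  then have w2: "q2 \<in> universal G B" "q2' \<in> universal G B"
    using p2_cases[of q2] p2_cases[of q2'] by auto
  have AB: "finite A" "finite B" using finite_pverts pverts_eq by auto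
  have mem: "p \<in> B" "q2 \<in> B" "q2' \<in> B" "d \<in> A" "q \<in> A" "q' \<in> A" using w w2 d(1) sub by auto
  have ne: "p \<noteq> x" "d \<noteq> x" "p \<noteq> d" "p \<notin> A" "d \<notin> B" using mem disj by auto
  have shape: "critical_shape (B - {p}) q2 q2' p d {x} (A - {d}) q q'"
  proof
    show "q \<in> A - {d} \<and> q' \<in> A - {d} \<and> {x} \<noteq> {} \<or> q \<in> {x} \<and> q' \<in> {x} \<and> (\<forall>r. A - {d} \<noteq> {r})"
      using mem p(2,3) by simp
    show "(B - {p}) \<inter> (A - {d}) = {}" using disj(1) by blast
  qed (use AB mem ne p(6) p2(2,3,6) disj(2,3) in simp_all)
  have "G = shape_graph (B - {p}) q2 q2' p d {x} (A - {d}) q q'"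
  proof (rule eq_shape_graph[OF shape])
    show "pverts G = B - {p} \<union> {p, d} \<union> {x} \<union> (A - {d})" using pverts_eq mem by blast
    have uni: "(z, v) \<in> parcs G" if "z \<in> universal G S" "v \<in> S" "v \<noteq> z" for z v S
      using that arcs_sym unfolding universal_def by blast
    show "(p, h) \<in> parcs G" if "h \<in> B - {p}" for h using uni[OF w(1)] that by simp
    show "(p, n) \<in> parcs G" if "n \<in> {x}" for n using w(2) that by simp
    show "(d, n) \<in> parcs G" if "n \<in> {x}" for n using d(4) that by simp
    show "(d, r) \<in> parcs G" if "r \<in> A - {d}" for r using uni[OF d(1)] that by simp
    show "(q2, h) \<in> parcs G" if "h \<in> B - {p}" "h \<noteq> q2" for h using uni[OF w2(1)] that by simp
    show "(q2', h) \<in> parcs G" if "h \<in> B - {p}" "h \<noteq> q2'" for h using uni[OF w2(2)] that by simp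
    show "(q, r) \<in> parcs G" if "r \<in> A - {d}" "r \<noteq> q" for r using uni[OF w(3)] that by simp
    show "(q', r) \<in> parcs G" if "r \<in> A - {d}" "r \<noteq> q'" for r using uni[OF w(4)] that by simp
  qed
  then show ?thesis using shape by blast
qed

text \<open>Staller's move \<open>d\<close> takes the only universal vertex of \<open>A\<close>, so
  both answering pairs contain \<open>x\<close>, whence \<open>p = x\<close>. Then \<open>q\<close>
  and \<open>q'\<close> each dominate everything in \<open>A\<close> that \<open>x\<close> misses,
  and are the natural candidates for the hubs \<open>y\<close>, \<open>y'\<close>.\<close>

lemma shape_if_one_universal:
  assumes d: "universal G A = {d}" and u: "u \<in> universal G B" "u' \<in> universal G B" "u \<noteq> u'"
    and card: "card (pverts G) \<ge> 4"
  shows "\<exists>H u u' z d N R y y'. critical_shape H u u' z d N R y y' \<and> G = shape_graph H u u' z d N R y y'"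
proof -
  interpret S: critical_cut G B A x by (rule swap)
  have dA: "d \<in> A" "\<And>v. v \<in> A \<Longrightarrow> v \<noteq> d \<Longrightarrow> (d, v) \<in> parcs G"
    using d arcs_sym unfolding universal_def by blast+
  have uB: "u \<in> B" "u' \<in> B" using u unfolding universal_def by auto
  have only_d: "z = d" if "z \<in> A" "\<And>v. v \<in> A \<Longrightarrow> v \<noteq> z \<Longrightarrow> (v, z) \<in> parcs G" for z
    using d that unfolding universal_def by blast
  have "d \<in> pverts G" using dA(1) pverts_eq by blast
  then obtain p q q' where p: "p \<noteq> d" "q \<noteq> d" "q' \<noteq> d" "p \<noteq> q" "p \<noteq> q'" "q \<noteq> q'"
    "dominating_set G {p, q}" "dominating_set G {p, q'}"
    using two_move_win_obtain[OF mb_critical_2_two_move_win(1)[OF finite_pverts critical] finite_pverts card]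
    by metis
  have "p = x \<or> q = x" "p = x \<or> q' = x"
    using dominating_pair_cases(1)[OF p(7)] dominating_pair_cases(1)[OF p(8)] p(1-3) d by auto
  then have px: "p = x" using p(6) by blast
  \<comment> \<open>If \<open>r\<close> were in \<open>B\<close>, then \<open>x\<close> would be
    adjacent to all of \<open>A\<close>, and \<open>x\<close> and \<open>d\<close> would be two
    universal vertices of \<open>A \<union> {x}\<close>.\<close>
  have in_A: "r \<in> A" if r: "r \<in> {q, q'}" for r
  proof (rule ccontr)
    assume "r \<notin> A"
    moreover have dom: "dominating_set G {x, r}" "r \<noteq> x" using r p px by auto
    ultimately have "r \<in> B" using pverts_eq unfolding dominating_set_pair_iff by blast
    then have all: "(a, x) \<in> parcs G" if "a \<in> A" for a using S.dominating_pair_x(1)[OF dom(1)] that by blast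
    show False
      using not_two_universal[of x d u u'] all dA disj u arcs_sym by blast
  qed
  have xB: "(x, b) \<in> parcs G" if "b \<in> B" for b
    using dominating_pair_x(1)[of q b] in_A p(7) px that arcs_sym by blast
  define N where "N = {v \<in> A - {d}. (v, x) \<in> parcs G}"
  define R where "R = {v \<in> A - {d}. (v, x) \<notin> parcs G}"
  have NR: "N \<inter> R = {}" "N \<union> R = A - {d}" by (auto simp: N_def R_def)
  have R_dom: "(r, v) \<in> parcs G" if "r \<in> {q, q'}" "v \<in> R" "v \<noteq> r" for r v
    using dominating_pair_x(2)[of r v] that in_A[OF that(1)] p(7,8) px arcs_sym by (auto simp: R_def)
  have AB: "finite A" "finite B" using finite_pverts pverts_eq by auto
  \<comment> \<open>Allowing \<open>N' \<subseteq> N\<close> makes it possible to move a vertex from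
    \<open>N\<close> into \<open>R'\<close>, giving up its edge to \<open>x\<close>.\<close>
  have finish: ?thesis
    if N': "N' \<subseteq> N" and R': "N' \<inter> R' = {}" "N' \<union> R' = A - {d}" and "y \<noteq> y'"
      and y: "y \<in> R' \<and> y' \<in> R' \<and> N' \<noteq> {} \<or> y \<in> N' \<and> y' \<in> N' \<and> (\<forall>r. R' \<noteq> {r})"
      and yR: "\<And>r. r \<in> R' \<Longrightarrow> r \<noteq> y \<Longrightarrow> (y, r) \<in> parcs G" "\<And>r. r \<in> R' \<Longrightarrow> r \<noteq> y' \<Longrightarrow> (y', r) \<in> parcs G"
    for N' R' y y'
  proof -
    have sub: "N' \<subseteq> A - {d}" "R' \<subseteq> A - {d}" using R' by auto
    have shape: "critical_shape B u u' x d N' R' y y'"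
    proof
      show "finite N'" "finite R'" using sub AB finite_subset by blast+
    qed (use y R'(1) sub dA(1) uB u(3) disj AB \<open>y \<noteq> y'\<close> in auto)
    have "G = shape_graph B u u' x d N' R' y y'"
    proof (rule eq_shape_graph[OF shape])
      show "pverts G = B \<union> {x, d} \<union> N' \<union> R'" using R'(2) pverts_eq dA(1) by blast
      show "(x, n) \<in> parcs G" if "n \<in> N'" for n using that N' arcs_sym by (auto simp: N_def)
      show "(d, n) \<in> parcs G" if "n \<in> N'" for n using that sub dA(2) by blast
      show "(d, r) \<in> parcs G" if "r \<in> R'" for r using that sub dA(2) by blast
      show "(u, h) \<in> parcs G" if "h \<in> B" "h \<noteq> u" for h
        using that u(1) arcs_sym unfolding universal_def by blast
      show "(u', h) \<in> parcs G" if "h \<in> B" "h \<noteq> u'" for h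
        using that u(2) arcs_sym unfolding universal_def by blast
    qed (use xB yR in blast)+
    then show ?thesis using shape by blast
  qed
  \<comment> \<open>With one hub in \<open>R\<close> and one in \<open>N\<close>, the latter is
    moved into \<open>R\<close>, so that both hubs lie in the new \<open>R\<close>.\<close>
  have mixed: ?thesis
    if y: "y \<in> R" "y' \<in> N" "\<And>r. r \<in> R \<Longrightarrow> r \<noteq> y \<Longrightarrow> (y, r) \<in> parcs G" "\<And>r. r \<in> R \<Longrightarrow> (y', r) \<in> parcs G"
    for y y'
  proof (rule finish)
    show "N - {y'} \<subseteq> N" by blast
    show "(N - {y'}) \<inter> (R \<union> {y'}) = {}" "(N - {y'}) \<union> (R \<union> {y'}) = A - {d}" using NR y(2) by auto
    show "y \<noteq> y'" using y NR by blast
    \<comment> \<open>Otherwise \<open>y'\<close> would see \<open>d\<close> and all of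
      \<open>R\<close>, and so be a second universal vertex of \<open>A\<close>.\<close>
    have "N \<noteq> {y'}"
    proof
      assume "N = {y'}"
      then have "y' = d"
        using only_d[of y'] y(4) NR(2) dA(2)[of y'] arcs_sym by (metis Diff_iff Un_iff insertCI singletonD singletonI)
      then show False using y(2) by (simp add: N_def)
    qed
    then show "y \<in> R \<union> {y'} \<and> y' \<in> R \<union> {y'} \<and> N - {y'} \<noteq> {} \<or>
        y \<in> N - {y'} \<and> y' \<in> N - {y'} \<and> (\<forall>r. R \<union> {y'} \<noteq> {r})"
      using y(1,2) by auto
    show "(y, r) \<in> parcs G" if "r \<in> R \<union> {y'}" "r \<noteq> y" for r
      using that y(1,3,4) arcs_sym by blast
    show "(y', r) \<in> parcs G" if "r \<in> R \<union> {y'}" "r \<noteq> y'" for r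
      using that y(4) by blast
  qed
  have mem: "q \<in> N \<union> R" "q' \<in> N \<union> R" using in_A p(2,3) NR(2) by auto
  consider "q \<in> R" "q' \<in> R" | "q \<in> R" "q' \<in> N" | "q \<in> N" "q' \<in> R"
    | r where "q \<in> N" "q' \<in> N" "R = {r}" | "q \<in> N" "q' \<in> N" "\<forall>r. R \<noteq> {r}"
    using mem by blast
  then show ?thesis
  proof cases
    case 1
    \<comment> \<open>If \<open>N\<close> were empty, \<open>q\<close> would be a second universal
      vertex of \<open>A\<close>.\<close>
    have "N \<noteq> {}"
    proof
      assume "N = {}"
      then have "q = d"
        using only_d[of q] in_A[of q] R_dom[of q] NR(2) dA(2)[of q] p(2) arcs_sym by blast
      then show False using p(2) by blast
    qed
    then show ?thesis using finish[of N R q q'] NR p(6) R_dom 1 by blast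
  next
    case 2
    then show ?thesis using mixed[of q q'] R_dom NR(1) by blast
  next
    case 3
    then show ?thesis using mixed[of q' q] R_dom NR(1) by blast
  next
    case 4
    \<comment> \<open>A one-element \<open>R\<close> admits no shape with hubs in \<open>N\<close>.
      Instead its vertex \<open>r\<close> becomes a hub together with \<open>q\<close>, which leaves
      \<open>N\<close>.\<close>
    then show ?thesis using mixed[of r q] R_dom[of q r] NR(1) by blast
  next
    case 5
    then show ?thesis using finish[of N R q q'] NR p(6) R_dom by blast
  qed
qed

text \<open>The last assumption records how the pairs \<open>{d, u}\<close> and
  \<open>{d, u'}\<close> dominate \<open>x\<close>. A second universal vertex of \<open>A\<close>
  prevents \<open>u\<close> and \<open>u'\<close> from both seeing \<open>x\<close>, so in that case
  \<open>d\<close> does.\<close>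

lemma shape_oriented:
  assumes d: "d \<in> universal G A" and u: "u \<in> universal G B" "u' \<in> universal G B" "u \<noteq> u'"
    and x: "(d, x) \<in> parcs G \<or> (u, x) \<in> parcs G \<and> (u', x) \<in> parcs G"
  shows "\<exists>H u u' z d N R y y'. critical_shape H u u' z d N R y y' \<and> G = shape_graph H u u' z d N R y y'"
proof -
  have mem: "d \<in> A" "u \<in> B" "u' \<in> B" using d u unfolding universal_def by auto
  then have "x \<noteq> d" "x \<noteq> u" "x \<noteq> u'" "d \<noteq> u" "d \<noteq> u'" using disj by auto
  then have "card {x, d, u, u'} = 4" using u(3) by simp
  moreover have "{x, d, u, u'} \<subseteq> pverts G" using mem pverts_eq by auto
  ultimately have card: "card (pverts G) \<ge> 4" using card_mono[OF finite_pverts] by metis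
  show ?thesis
  proof (cases "universal G A = {d}")
    case True
    then show ?thesis using shape_if_one_universal u card by blast
  next
    case False
    then obtain d' where d': "d' \<in> universal G A" "d \<noteq> d'" using d by blast
    interpret S: critical_cut G B A x by (rule swap)
    have "(d, x) \<in> parcs G"
      using x S.unique_universal_neighbour[OF u(1,2) _ _ d d'] u(3) by blast
    then show ?thesis using shape_if_two_universal[OF d d' _ u card] by blast
  qed
qed

lemma shape:
  "\<exists>H u u' z d N R y y'. critical_shape H u u' z d N R y y' \<and> G = shape_graph H u u' z d N R y y'"
proof -
  interpret S: critical_cut G B A x by (rule swap)
  have "x \<in> pverts G" using pverts_eq by blast
  then obtain p where p: "p \<in> pverts G - {x}" "dominating_set G {p} \<or>
     (\<exists>q q'. q \<noteq> q' \<and> q \<notin> {x, p} \<and> q' \<notin> {x, p} \<and>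
        dominating_set G {p, q} \<and> dominating_set G {p, q'})"
    using mb_critical_2_two_move_win(1)[OF finite_pverts critical] unfolding two_move_win_def by blast
  have "\<not> dominating_set G {p}"
  proof
    assume "dominating_set G {p}"
    \<comment> \<open>Read as a degenerate pair, \<open>p\<close> would have to lie on both
      sides.\<close>
    then have "dominating_set G {p, p}" by simp
    then show False
      using dominating_pair_cases(1)[of p p] p(1) disj unfolding universal_def by auto
  qed
  then obtain q q' where q: "q \<noteq> q'" "q \<noteq> x" "q' \<noteq> x" "dominating_set G {p, q}" "dominating_set G {p, q'}"
    using p by blast
  have px: "p \<noteq> x" using p by blast
  have "universal G A \<inter> universal G B = {}" using disj unfolding universal_def by blast
  then consider "p \<in> universal G A" "q \<in> universal G B" "q' \<in> universal G B"
    | "p \<in> universal G B" "q \<in> universal G A" "q' \<in> universal G A"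
    using dominating_pair_cases(1)[OF q(4) px q(2)] dominating_pair_cases(1)[OF q(5) px q(3)] by blast
  moreover have "(p, x) \<in> parcs G \<or> (q, x) \<in> parcs G \<and> (q', x) \<in> parcs G"
    using dominating_pair_cases(2)[OF q(4) px q(2)] dominating_pair_cases(2)[OF q(5) px q(3)] by blast
  ultimately show ?thesis
    using shape_oriented[of p q q'] S.shape_oriented[of p q q'] q(1) by cases blast+
qed

end

section \<open>From a cut-vertex to the two sides\<close>

lemma critical_cut_exists:
  assumes graph: "pair_graph G" and conn: "Digraph_Component.connected (with_proj G)"
    and cut: "cut_vertex G x" and critical: "mb_critical 2 G"
  shows "\<exists>A B. critical_cut G A B x"
proof -
  interpret pair_graph G by (rule graph)
  let ?V = "pverts G" and ?D = "pre_digraph.del_vert (with_proj G) x"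
  have x: "x \<in> ?V" using cut unfolding cut_vertex_def by blast
  \<comment> \<open>By convention the vertex of \<open>K_1\<close> is a cut-vertex; there Dominator
    has no move at all, so that graph is not critical.\<close>
  have "?V \<noteq> {x}"
  proof
    assume "?V = {x}"
    then have "\<not> two_move_win G" using x unfolding two_move_win_def by auto
    then show False using mb_critical_2_two_move_win(1)[OF pair_finite_verts critical] by blast
  qed
  then have "verts ?D \<noteq> {}" using x by (auto simp: del_vert_simps)
  moreover have "\<not> Digraph_Component.connected ?D" using cut unfolding cut_vertex_def by blast
  moreover define crossed where
    "crossed A \<longleftrightarrow> (\<exists>a \<in> A. \<exists>b \<in> verts ?D - A. (a, b) \<in> (arcs_ends ?D)\<^sup>s)" for A
  ultimately have "\<not> (\<forall>A. A \<noteq> {} \<and> A \<subset> verts ?D \<longrightarrow> crossed A)"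
    unfolding connected_iff_crossing[OF wf_digraph_del_vert] crossed_def by argo
  then obtain A where A: "A \<noteq> {}" "A \<subset> verts ?D" "\<not> crossed A" by metis
  define B where "B = ?V - {x} - A"
  have V: "verts ?D = ?V - {x}" by (simp add: del_vert_simps)
  have AB: "?V = A \<union> B \<union> {x}" "A \<inter> B = {}" "x \<notin> A" "x \<notin> B" "B \<noteq> {}"
    using A(2) x unfolding V B_def by auto
  have no: "(a, b) \<notin> parcs G" if "a \<in> A" "b \<in> B" for a b
  proof
    assume "(a, b) \<in> parcs G"
    then have "(a, b) \<in> arcs_ends ?D"
      using that AB by (auto simp: arcs_ends_conv del_vert_simps)
    then have "(a, b) \<in> (arcs_ends ?D)\<^sup>s" by (simp add: symcl_def)
    moreover have "b \<in> verts ?D - A" using that(2) unfolding V B_def by blast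
    ultimately show False using A(3) that(1) unfolding crossed_def by blast
  qed
  have crossing: "\<exists>a \<in> S. \<exists>b \<in> ?V - S. (a, b) \<in> parcs G" if "S \<noteq> {}" "S \<subset> ?V" for S
  proof -
    have "\<exists>a \<in> S. \<exists>b \<in> ?V - S. (a, b) \<in> (parcs G)\<^sup>s"
      using conn that connected_iff_crossing[of "with_proj G"] wf_digraph_axioms by auto
    then show ?thesis using arcs_symmetric by (auto simp: symcl_def)
  qed
  have "\<exists>a \<in> A. (a, x) \<in> parcs G"
    using crossing[of A] AB A(1) no by blast
  moreover have "\<exists>b \<in> B. (b, x) \<in> parcs G"
    using crossing[of B] AB no arcs_symmetric by blast
  ultimately have "critical_cut G A B x"
    using graph critical AB no by unfold_locales auto
  then show ?thesis by blast
qed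

theorem theorem2p7:
  fixes G :: "'a pair_pre_digraph"
  assumes "pair_graph G"
    and "Digraph_Component.connected (with_proj G)"
    and "\<exists>x \<in> pverts G. cut_vertex G x"
  shows "mb_critical 2 G \<longleftrightarrow> in_family_F G \<or> in_family_F' G"
proof
  assume critical: "mb_critical 2 G"
  obtain x where "cut_vertex G x" using assms(3) by blast
  then obtain A B where "critical_cut G A B x"
    using critical_cut_exists[OF assms(1,2) _ critical] by blast
  from critical_cut.shape[OF this] obtain H u u' z d N R y y' where
    "critical_shape H u u' z d N R y y'" "G = shape_graph H u u' z d N R y y'"
    by (elim exE conjE)
  then show "in_family_F G \<or> in_family_F' G" using critical_shape.family_shape by simp
next
  assume family: "in_family_F G \<or> in_family_F' G"
  interpret pair_graph G by fact
  from family_imp_shape[OF pair_wf_digraph family] obtain H u u' z d N R y y' where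
    "critical_shape H u u' z d N R y y'" "G = shape_graph H u u' z d N R y y'"
    by (elim exE conjE)
  then show "mb_critical 2 G" using critical_shape.mb_critical_shape by simp
qed

end
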